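(* Assume $(A_2)$ and $(A_5)$ hold. Then the system $\{\sin\sqrt{\mu_{nk}}\,t\}_{n\in\mathbb N,\,k=1,2}$ is a Riesz basis in $L_2(0,2\pi)$.
   Context: Let $m\ge 4$ and $2\le p\le m-2$ be integers. Let $G$ be a star-shaped graph with $m$ edges of length $\pi$, edge $e_j$ parametrized by $x_j\in[0,\pi]$, $x_j=0$ the boundary vertex, $x_j=\pi$ the common internal vertex. For $j=1,\dots,m$ let $\sigma_j\in L_2(0,\pi)$ be real-valued; $y_j^{[1]}=y_j'-\sigma_j y_j$ and $\ell_j y_j=-(y_j^{[1]})'-\sigma_j y_j^{[1]}-\sigma_j^2 y_j$ with domain $\{y_j\in W_2^1[0,\pi]: y_j^{[1]}\in W_1^1[0,\pi],\ \ell_j y_j\in L_2(0,\pi)\}$. The problem $L_0$ is the system $\ell_j y_j=\lambda y_j$ ($j=1,\dots,m$) with matching conditions $y_1(\pi)=y_j(\pi)$ ($j=2,\dots,m$), $\sum_{j=1}^m y_j^{[1]}(\pi)=0$, and boundary conditions $y_j^{[1]}(0)=0$ ($j=1,\dots,p+1$), $y_j(0)=0$ ($j=p+2,\dots,m$). Let $C_j(x,\lambda)$ ($j=1,\dots,p+1$) and $S_j(x,\lambda)$ ($j=p+1,\dots,m$) be the solutions of $\ell_j y=\lambda y$ with $C_j(0,\lambda)=1$, $C_j^{[1]}(0,\lambda)=0$, $S_j(0,\lambda)=0$, $S_j^{[1]}(0,\lambda)=1$. Let $\alpha_1=\arccos\sqrt{(p+1)/m}$ and $\{\varkappa_n\}$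 denote various $\ell_2$ sequences. Let $\{\mu_{nk}\}_{n\in\mathbb N,k=1,2}$ be eigenvalues of $L_0$ satisfying $\sqrt{\mu_{n1}}=n-1+\alpha_1/\pi+\varkappa_n$, $\sqrt{\mu_{n2}}=n-\alpha_1/\pi+\varkappa_n$. Assumption $(A_2)$: $C_j(\pi,\mu_{nk})\ne0$ for $j=1,\dots,p+1$ and $S_j(\pi,\mu_{nk})\ne0$ for $j=p+1,\dots,m$, for all $n\in\mathbb N$, $k=1,2$. Assumption $(A_5)$: the numbers $\mu_{nk}$ are pairwise distinct and positive. *)

theory Defs
  imports "HOL-Analysis.Analysis"
begin

definition real_L2_on :: "real set \<Rightarrow> (real \<Rightarrow> real) \<Rightarrow> bool" where
  "real_L2_on S f \<longleftrightarrow> set_borel_measurable lborel S f \<and>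
     set_integrable lborel S (\<lambda>t. (f t)^2)"

text \<open>qd_solution sig lam y z: y solves l y = lam y on [0,pi], where z is (the absolutely
  continuous representative of) the quasi-derivative y^[1] = y' - sig y.  The equation
  l y = lam y with l y = -(y^[1])' - sig y^[1] - sig^2 y is written as the first order system
  y' = sig y + z,  z' = -sig z - sig^2 y - lam y  in integrated (absolutely continuous) form.\<close>
definition qd_solution ::
  "(real \<Rightarrow> real) \<Rightarrow> complex \<Rightarrow> (real \<Rightarrow> complex) \<Rightarrow> (real \<Rightarrow> complex) \<Rightarrow> bool" where
  "qd_solution sig lam y z \<longleftrightarrow>
    (\<forall>x\<in>{0..pi}.
       set_integrable lborel {0..x} (\<lambda>t. sig t *\<^sub>R y t + z t) \<and>
       y x = y 0 + set_lebesgue_integral lborel {0..x} (\<lambda>t. sig t *\<^sub>R y t + z t) \<and>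
       set_integrable lborel {0..x} (\<lambda>t. sig t *\<^sub>R z t + ((sig t)^2) *\<^sub>R y t + lam * y t) \<and>
       z x = z 0 - set_lebesgue_integral lborel {0..x}
                     (\<lambda>t. sig t *\<^sub>R z t + ((sig t)^2) *\<^sub>R y t + lam * y t))"

definition C_pi :: "(real \<Rightarrow> real) \<Rightarrow> complex \<Rightarrow> complex" where
  "C_pi sig lam = (THE c. \<exists>y z. qd_solution sig lam y z \<and> y 0 = 1 \<and> z 0 = 0 \<and> y pi = c)"

definition S_pi :: "(real \<Rightarrow> real) \<Rightarrow> complex \<Rightarrow> complex" where
  "S_pi sig lam = (THE c. \<exists>y z. qd_solution sig lam y z \<and> y 0 = 0 \<and> z 0 = 1 \<and> y pi = c)"

text \<open>Y j, Z j are y_j and y_j^[1] on edge j (j = 1..m).\<close>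
definition L0_eigenvalue :: "nat \<Rightarrow> nat \<Rightarrow> (nat \<Rightarrow> real \<Rightarrow> real) \<Rightarrow> complex \<Rightarrow> bool" where
  "L0_eigenvalue m p sig lam \<longleftrightarrow>
    (\<exists>Y Z :: nat \<Rightarrow> real \<Rightarrow> complex.
       (\<forall>j\<in>{1..m}. qd_solution (sig j) lam (Y j) (Z j)) \<and>
       (\<forall>j\<in>{2..m}. Y 1 pi = Y j pi) \<and>
       (\<Sum>j=1..m. Z j pi) = 0 \<and>
       (\<forall>j\<in>{1..p+1}. Z j 0 = 0) \<and>
       (\<forall>j\<in>{p+2..m}. Y j 0 = 0) \<and>
       (\<exists>j\<in>{1..m}. \<exists>x\<in>{0..pi}. Y j x \<noteq> 0))"

definition L2 :: "real \<Rightarrow> real \<Rightarrow> (real \<Rightarrow> complex) \<Rightarrow> bool" where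
  "L2 a b g \<longleftrightarrow> set_borel_measurable lborel {a..b} g \<and>
     set_integrable lborel {a..b} (\<lambda>t. (cmod (g t))^2)"

definition L2_inner :: "real \<Rightarrow> real \<Rightarrow> (real \<Rightarrow> complex) \<Rightarrow> (real \<Rightarrow> complex) \<Rightarrow> complex" where
  "L2_inner a b f g = set_lebesgue_integral lborel {a..b} (\<lambda>t. f t * cnj (g t))"

definition L2_norm :: "real \<Rightarrow> real \<Rightarrow> (real \<Rightarrow> complex) \<Rightarrow> real" where
  "L2_norm a b f = sqrt (set_lebesgue_integral lborel {a..b} (\<lambda>t. (cmod (f t))^2))"

definition L2_orthonormal_basis ::
  "real \<Rightarrow> real \<Rightarrow> ('i \<Rightarrow> real \<Rightarrow> complex) \<Rightarrow> 'i set \<Rightarrow> bool" where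
  "L2_orthonormal_basis a b e I \<longleftrightarrow>
     (\<forall>i\<in>I. L2 a b (e i)) \<and>
     (\<forall>i\<in>I. \<forall>j\<in>I. L2_inner a b (e i) (e j) = (if i = j then 1 else 0)) \<and>
     (\<forall>g. L2 a b g \<longrightarrow> (\<forall>i\<in>I. L2_inner a b g (e i) = 0) \<longrightarrow> L2_norm a b g = 0)"

text \<open>Riesz basis of L_2(a,b): the image of an orthonormal basis under a bounded linear
  operator on L_2(a,b) with bounded inverse (functions are identified up to null sets,
  i.e. up to zero L_2 norm).\<close>
definition L2_riesz_basis ::
  "real \<Rightarrow> real \<Rightarrow> ('i \<Rightarrow> real \<Rightarrow> complex) \<Rightarrow> 'i set \<Rightarrow> bool" where
  "L2_riesz_basis a b f I \<longleftrightarrow>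
    (\<exists>(e :: 'i \<Rightarrow> real \<Rightarrow> complex) (T :: (real \<Rightarrow> complex) \<Rightarrow> (real \<Rightarrow> complex)) C D.
       L2_orthonormal_basis a b e I \<and>
       (\<forall>g. L2 a b g \<longrightarrow> L2 a b (T g)) \<and>
       (\<forall>g h (\<alpha>::complex) \<beta>. T (\<lambda>t. \<alpha> * g t + \<beta> * h t) = (\<lambda>t. \<alpha> * T g t + \<beta> * T h t)) \<and>
       (\<forall>g. L2 a b g \<longrightarrow> L2_norm a b (T g) \<le> C * L2_norm a b g) \<and>
       (\<forall>g. L2 a b g \<longrightarrow> L2_norm a b g \<le> D * L2_norm a b (T g)) \<and>
       (\<forall>h. L2 a b h \<longrightarrow> (\<exists>g. L2 a b g \<and> L2_norm a b (\<lambda>t. T g t - h t) = 0)) \<and>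
       (\<forall>i\<in>I. L2_norm a b (\<lambda>t. T (e i) t - f i t) = 0))"

end

theory Submission
  imports Defs "HOL-Library.Nat_Bijection" "HOL-Library.Function_Algebras"
begin

text \<open>With \<open>\<alpha> = \<alpha>\<^sub>1 / \<pi> \<in> (0, 1/2)\<close>, the unperturbed frequencies are \<open>\<bar>k + \<alpha>\<bar>\<close>, \<open>k \<in> \<int>\<close>, and
  \<open>g(t) \<mapsto> (e\<^sup>i\<^sup>\<alpha>\<^sup>t g(t) - e\<^sup>-\<^sup>i\<^sup>\<alpha>\<^sup>t g(2\<pi> - t)) / 2i\<close> sends \<open>e\<^sup>i\<^sup>k\<^sup>t\<close> to \<open>sin ((k + \<alpha>) t)\<close>; for fixed \<open>t\<close> it is
  a 2 by 2 system in \<open>g(t), g(2\<pi> - t)\<close> whose determinant is a multiple of \<open>sin (2\<pi>\<alpha>) \<noteq> 0\<close>, hence an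
  isomorphism.  The true frequencies are an \<open>\<ell>\<^sub>2\<close> perturbation, so changing all but finitely many of
  them is a perturbation of small norm, which a Neumann series inverts.  The remaining finitely many
  frequencies are replaced one at a time.  Replacing \<open>\<nu>\<close> by \<open>\<rho>\<close> is a rank one perturbation, which can
  fail to be invertible only if \<open>sin \<rho>t\<close> is a series in the other sines; applying to this series the
  solution operator of \<open>y'' + \<nu>\<^sup>2 y = g\<close>, \<open>y(0) = y'(0) = 0\<close>, yields a second, independent relation,
  which contradicts the basis property before the replacement.\<close>

section \<open>Square integrable functions on an interval\<close>

text \<open>What replaces it is that the perturbation \<open>D\<close> is bounded into the sup norm:
  at a fixed t, Cauchy-Schwarz pairs the Fourier coefficients of g with the differences of perturbed
  and unperturbed sines, and the l2 norm of these differences is at most 2\<pi> times that of the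
  frequency shifts. Hence the Neumann series converges uniformly. Smallness is gained by leaving a
  finite head of frequencies unchanged; the true head frequencies may lie far from the unperturbed
  ones, so no smallness argument reaches them and they need the replacement step. There the relation
  between sines cannot be differentiated twice term by term; the solution operator is integration
  against a Green kernel and is bounded. Giving this kernel the frequency that is being replaced
  makes its extra term a multiple of the very sine that is absent from the relation.\<close>

lemma L2_iff:
  "L2 a b g \<longleftrightarrow> g \<in> borel_measurable (restrict_space lborel {a..b}) \<and>
     integrable (restrict_space lborel {a..b}) (\<lambda>t. (cmod (g t))^2)"
  unfolding L2_def set_borel_measurable_def set_integrable_def
  by (simp add: integrable_restrict_space borel_measurable_restrict_space_iff)

lemma set_lebesgue_integral_restrict_space:
  fixes f :: "real \<Rightarrow> 'b::{banach, second_countable_topology}"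
  shows "set_lebesgue_integral lborel {a..b} f = integral\<^sup>L (restrict_space lborel {a..b}) f"
  unfolding set_lebesgue_integral_def by (simp add: integral_restrict_space)

lemma finite_measure_Icc: "finite_measure (restrict_space lborel {a..b::real})"
  by (rule finite_measureI) (simp add: emeasure_restrict_space space_restrict_space emeasure_lborel_Icc_eq)

lemma L2_norm_eq: "L2_norm a b f = sqrt (\<integral>t. (cmod (f t))^2 \<partial>restrict_space lborel {a..b})"
  unfolding L2_norm_def set_lebesgue_integral_restrict_space ..

lemma L2_inner_eq: "L2_inner a b f g = (\<integral>t. f t * cnj (g t) \<partial>restrict_space lborel {a..b})"
  unfolding L2_inner_def set_lebesgue_integral_restrict_space ..

lemma L2_norm_nonneg [simp]: "0 \<le> L2_norm a b f"
  unfolding L2_norm_eq by simp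

lemma L2_norm_square:
  "(L2_norm a b f)^2 = (\<integral>t. (cmod (f t))^2 \<partial>restrict_space lborel {a..b})"
  unfolding L2_norm_eq by simp

lemma L2_norm_cong: "(\<And>t. t \<in> {a..b} \<Longrightarrow> f t = g t) \<Longrightarrow> L2_norm a b f = L2_norm a b g"
  unfolding L2_norm_eq
  by (intro arg_cong[where f=sqrt] Bochner_Integration.integral_cong) (auto simp: space_restrict_space)

lemma L2_measurable: "L2 a b g \<Longrightarrow> g \<in> borel_measurable (restrict_space lborel {a..b})"
  unfolding L2_iff by (rule conjunct1)

lemma L2_integrable_square:
  "L2 a b g \<Longrightarrow> integrable (restrict_space lborel {a..b}) (\<lambda>t. (cmod (g t))^2)"
  unfolding L2_iff by (rule conjunct2)

lemma L2_I:
  "g \<in> borel_measurable (restrict_space lborel {a..b}) \<Longrightarrow>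
    integrable (restrict_space lborel {a..b}) (\<lambda>t. (cmod (g t))^2) \<Longrightarrow> L2 a b g"
  unfolding L2_iff by (rule conjI)

lemma borel_measurable_cnj [measurable (raw)]:
  "f \<in> borel_measurable M \<Longrightarrow> (\<lambda>x. cnj (f x)) \<in> borel_measurable M"
  by (rule measurable_compose[OF _ borel_measurable_continuous_onI]) (auto intro: continuous_intros)

lemma L2_integrable_mult:
  assumes "L2 a b f" "L2 a b g"
  shows "integrable (restrict_space lborel {a..b}) (\<lambda>t. f t * cnj (g t))"
    and "integrable (restrict_space lborel {a..b}) (\<lambda>t. cmod (f t) * cmod (g t))"
proof -
  note [measurable] = assms[THEN L2_measurable]
  have I: "integrable (restrict_space lborel {a..b}) (\<lambda>t. (cmod (f t))^2 + (cmod (g t))^2)"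
    by (intro Bochner_Integration.integrable_add L2_integrable_square assms)
  have le: "cmod (f t) * cmod (g t) \<le> (cmod (f t))^2 + (cmod (g t))^2" for t
    using sum_squares_bound[of "cmod (f t)" "cmod (g t)"]
    using mult_nonneg_nonneg[OF norm_ge_zero[of "f t"] norm_ge_zero[of "g t"]] by linarith
  show "integrable (restrict_space lborel {a..b}) (\<lambda>t. f t * cnj (g t))"
  proof (rule Bochner_Integration.integrable_bound[OF I])
    show "AE t in restrict_space lborel {a..b}. norm (f t * cnj (g t)) \<le> norm ((cmod (f t))^2 + (cmod (g t))^2)"
      by (rule AE_I2) (simp add: norm_mult le)
  qed measurable
  show "integrable (restrict_space lborel {a..b}) (\<lambda>t. cmod (f t) * cmod (g t))"
  proof (rule Bochner_Integration.integrable_bound[OF I])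
    show "AE t in restrict_space lborel {a..b}. norm (cmod (f t) * cmod (g t)) \<le> norm ((cmod (f t))^2 + (cmod (g t))^2)"
      by (rule AE_I2) (simp add: norm_mult le)
  qed measurable
qed

lemma L2_add:
  assumes "L2 a b f" "L2 a b g"
  shows "L2 a b (\<lambda>t. f t + g t)"
proof -
  note [measurable] = assms[THEN L2_measurable]
  have I: "integrable (restrict_space lborel {a..b}) (\<lambda>t. 2 * (cmod (f t))^2 + 2 * (cmod (g t))^2)"
    by (intro Bochner_Integration.integrable_add integrable_mult_right L2_integrable_square assms)
  have "(cmod (f t + g t))^2 \<le> 2 * (cmod (f t))^2 + 2 * (cmod (g t))^2" for t
    using power_mono[OF norm_triangle_ineq[of "f t" "g t"], of 2]
      sum_squares_bound[of "cmod (f t)" "cmod (g t)"]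
    by (simp add: power2_sum)
  then have "AE t in restrict_space lborel {a..b}.
      norm ((cmod (f t + g t))^2) \<le> norm (2 * (cmod (f t))^2 + 2 * (cmod (g t))^2)"
    by (intro AE_I2) simp
  then have "integrable (restrict_space lborel {a..b}) (\<lambda>t. (cmod (f t + g t))^2)"
    by (intro Bochner_Integration.integrable_bound[OF I]) measurable
  then show ?thesis by (intro L2_I) measurable
qed

lemma L2_scale:
  assumes "L2 a b f"
  shows "L2 a b (\<lambda>t. c * f t)"
proof -
  note [measurable] = assms[THEN L2_measurable]
  have "integrable (restrict_space lborel {a..b}) (\<lambda>t. (cmod c)^2 * (cmod (f t))^2)"
    by (intro integrable_mult_right L2_integrable_square assms)
  then have "integrable (restrict_space lborel {a..b}) (\<lambda>t. (cmod (c * f t))^2)"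
    by (simp only: norm_mult power_mult_distrib)
  then show ?thesis by (intro L2_I) measurable
qed

lemma L2_minus: "L2 a b f \<Longrightarrow> L2 a b (\<lambda>t. - f t)"
  using L2_scale[of a b f "-1"] by simp

lemma L2_diff: "L2 a b f \<Longrightarrow> L2 a b g \<Longrightarrow> L2 a b (\<lambda>t. f t - g t)"
  using L2_add[of a b f "\<lambda>t. - g t"] L2_minus[of a b g] by simp

lemma L2_zero [simp]: "L2 a b (\<lambda>t. 0)"
  unfolding L2_iff by simp

lemma L2_sum:
  "(\<And>i. i \<in> A \<Longrightarrow> L2 a b (f i)) \<Longrightarrow> L2 a b (\<lambda>t. \<Sum>i\<in>A. f i t)"
proof (induction A rule: infinite_finite_induct)
  case (insert i A)
  then show ?case using L2_add[of a b "f i" "\<lambda>t. \<Sum>i\<in>A. f i t"] by simp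
qed simp_all

lemma L2_bounded:
  assumes "f \<in> borel_measurable (restrict_space lborel {a..b})" "\<And>t. t \<in> {a..b} \<Longrightarrow> cmod (f t) \<le> c"
  shows "L2 a b f"
proof -
  interpret finite_measure "restrict_space lborel {a..b}" by (rule finite_measure_Icc)
  note [measurable] = assms(1)
  have "AE t in restrict_space lborel {a..b}. norm ((cmod (f t))^2) \<le> c^2"
  proof (rule AE_I2)
    fix t assume "t \<in> space (restrict_space lborel {a..b})"
    then have "cmod (f t) \<le> c" by (intro assms(2)) (simp add: space_restrict_space)
    then show "norm ((cmod (f t))^2) \<le> c^2" by (simp add: power_mono)
  qed
  then have "integrable (restrict_space lborel {a..b}) (\<lambda>t. (cmod (f t))^2)"
    by (rule integrable_const_bound) measurable
  then show ?thesis by (intro L2_I) measurable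
qed

lemma L2_continuous:
  assumes "continuous_on {a..b} f"
  shows "L2 a b f"
proof -
  have "bounded (f ` {a..b})" using assms by (intro compact_imp_bounded compact_continuous_image) auto
  then obtain c where "\<And>t. t \<in> {a..b} \<Longrightarrow> cmod (f t) \<le> c" unfolding bounded_iff by blast
  moreover have "f \<in> borel_measurable (restrict_space lborel {a..b})"
    using borel_measurable_continuous_on_restrict[OF assms]
    by (subst measurable_cong_sets[OF sets_restrict_space_cong[OF sets_lborel] refl])
  ultimately show ?thesis by (rule L2_bounded[rotated])
qed

lemma L2_inner_add_left:
  assumes "L2 a b f" "L2 a b g" "L2 a b h"
  shows "L2_inner a b (\<lambda>t. f t + g t) h = L2_inner a b f h + L2_inner a b g h"
  unfolding L2_inner_eq using L2_integrable_mult(1)[OF assms(1,3)] L2_integrable_mult(1)[OF assms(2,3)]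
  by (simp add: distrib_right)

lemma L2_inner_scale_left:
  "L2_inner a b (\<lambda>t. c * f t) h = c * L2_inner a b f h"
  unfolding L2_inner_eq by (simp add: mult.assoc)

lemma L2_inner_commute: "L2_inner a b f g = cnj (L2_inner a b g f)"
  unfolding L2_inner_eq using Bochner_Integration.integral_cnj[of "restrict_space lborel {a..b}" "\<lambda>t. g t * cnj (f t)"]
  by (simp add: mult.commute)

lemma L2_inner_diff_left:
  assumes "L2 a b f" "L2 a b g" "L2 a b h"
  shows "L2_inner a b (\<lambda>t. f t - g t) h = L2_inner a b f h - L2_inner a b g h"
  unfolding L2_inner_eq using L2_integrable_mult(1)[OF assms(1,3)] L2_integrable_mult(1)[OF assms(2,3)]
  by (simp add: left_diff_distrib)

lemma L2_inner_sum_left: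
  assumes "\<And>i. i \<in> A \<Longrightarrow> L2 a b (f i)" "L2 a b h"
  shows "L2_inner a b (\<lambda>t. \<Sum>i\<in>A. f i t) h = (\<Sum>i\<in>A. L2_inner a b (f i) h)"
  unfolding L2_inner_eq using L2_integrable_mult(1)[OF assms(1) assms(2)]
  by (simp add: sum_distrib_right)

lemma L2_inner_self: "L2_inner a b f f = complex_of_real ((L2_norm a b f)^2)"
  unfolding L2_inner_eq L2_norm_square integral_complex_of_real[symmetric]
  by (simp only: complex_norm_square)

text \<open>Discriminant criterion: evaluate at the minimiser \<open>C / B\<close>; for
  \<open>B = 0\<close> an affine function bounded below must be constant.\<close>

lemma quadratic_nonneg_imp:
  fixes A B C :: real
  assumes q: "\<And>x. 0 \<le> A - 2 * x * C + x^2 * B" and B: "0 \<le> B"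
  shows "C^2 \<le> A * B"
proof (cases "B = 0")
  case True
  have "C = 0"
  proof (rule ccontr)
    assume "C \<noteq> 0"
    \<comment> \<open>At this point the expression equals -1.\<close>
    then show False using q[of "(A + 1) / (2 * C)"] True by simp
  qed
  then show ?thesis using True by simp
next
  case False
  then have "2 * (C / B) * C - (C / B)^2 * B = C^2 / B" by (simp add: power2_eq_square)
  then have "C^2 / B \<le> A" using q[of "C / B"] by linarith
  then show ?thesis using False B by (simp add: pos_divide_le_eq)
qed

text \<open>Stated for the integral of moduli, so that it yields both the bound on
  \<open>L2_inner\<close> and the triangle inequality.\<close>

lemma L2_Cauchy_Schwarz:
  assumes f: "L2 a b f" and g: "L2 a b g"
  shows "(\<integral>t. cmod (f t) * cmod (g t) \<partial>restrict_space lborel {a..b}) \<le> L2_norm a b f * L2_norm a b g"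
    (is "?C \<le> _")
proof -
  let ?M = "restrict_space lborel {a..b}"
  let ?A = "\<integral>t. (cmod (f t))^2 \<partial>?M" and ?B = "\<integral>t. (cmod (g t))^2 \<partial>?M"
  note int = L2_integrable_mult(2)[OF f g] f[THEN L2_integrable_square] g[THEN L2_integrable_square]
  have nn: "0 \<le> ?A" "0 \<le> ?B" "0 \<le> ?C" by auto
  have q: "0 \<le> ?A - 2 * x * ?C + x^2 * ?B" for x :: real
  proof -
    have "0 \<le> (\<integral>t. (cmod (f t) - x * cmod (g t))^2 \<partial>?M)" by simp
    also have "\<dots> = (\<integral>t. (cmod (f t))^2 - 2 * x * (cmod (f t) * cmod (g t)) + x^2 * (cmod (g t))^2 \<partial>?M)"
      by (simp add: power2_diff power_mult_distrib algebra_simps)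
    also have "\<dots> = ?A - 2 * x * ?C + x^2 * ?B" using int by simp
    finally show ?thesis .
  qed
  have "?C^2 \<le> ?A * ?B" using q nn(2) by (rule quadratic_nonneg_imp)
  then have "?C \<le> sqrt (?A * ?B)" by (rule real_le_rsqrt)
  then show ?thesis unfolding L2_norm_eq by (simp add: real_sqrt_mult)
qed

lemma L2_inner_bound:
  assumes "L2 a b f" "L2 a b g"
  shows "cmod (L2_inner a b f g) \<le> L2_norm a b f * L2_norm a b g"
proof -
  have "cmod (L2_inner a b f g) \<le> (\<integral>t. cmod (f t * cnj (g t)) \<partial>restrict_space lborel {a..b})"
    unfolding L2_inner_eq by (rule integral_norm_bound)
  then show ?thesis using L2_Cauchy_Schwarz[OF assms] by (simp add: norm_mult)
qed

lemma L2_norm_scale: "L2_norm a b (\<lambda>t. c * f t) = cmod c * L2_norm a b f"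
  unfolding L2_norm_eq by (simp add: norm_mult power_mult_distrib real_sqrt_mult)

lemma L2_norm_minus: "L2_norm a b (\<lambda>t. - f t) = L2_norm a b f"
  unfolding L2_norm_eq by simp

lemma L2_norm_minus_commute: "L2_norm a b (\<lambda>t. f t - g t) = L2_norm a b (\<lambda>t. g t - f t)"
  unfolding L2_norm_eq by (simp add: norm_minus_commute)

lemma L2_norm_mono:
  assumes "L2 a b g" "\<And>t. t \<in> {a..b} \<Longrightarrow> cmod (f t) \<le> cmod (g t)"
  shows "L2_norm a b f \<le> L2_norm a b g"
  unfolding L2_norm_eq
  using assms by (intro real_sqrt_le_mono integral_mono') (auto simp: L2_iff space_restrict_space intro: power_mono)

lemma L2_norm_triangle:
  assumes f: "L2 a b f" and g: "L2 a b g"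
  shows "L2_norm a b (\<lambda>t. f t + g t) \<le> L2_norm a b f + L2_norm a b g"
proof -
  let ?M = "restrict_space lborel {a..b}"
  note int = L2_integrable_mult(2)[OF f g] f[THEN L2_integrable_square] g[THEN L2_integrable_square]
  have "(L2_norm a b (\<lambda>t. f t + g t))^2 = (\<integral>t. (cmod (f t + g t))^2 \<partial>?M)"
    by (rule L2_norm_square)
  also have "\<dots> \<le> (\<integral>t. (cmod (f t))^2 + 2 * (cmod (f t) * cmod (g t)) + (cmod (g t))^2 \<partial>?M)"
  proof (intro integral_mono)
    show "(cmod (f t + g t))^2 \<le> (cmod (f t))^2 + 2 * (cmod (f t) * cmod (g t)) + (cmod (g t))^2" for t
      using power_mono[OF norm_triangle_ineq[of "f t" "g t"], of 2] by (simp add: power2_sum)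
  qed (intro Bochner_Integration.integrable_add integrable_mult_right int L2_integrable_square L2_add f g)+
  also have "\<dots> = (L2_norm a b f)^2 + 2 * (\<integral>t. cmod (f t) * cmod (g t) \<partial>?M) + (L2_norm a b g)^2"
    using int by (simp add: L2_norm_square)
  also have "\<dots> \<le> (L2_norm a b f + L2_norm a b g)^2"
    using L2_Cauchy_Schwarz[OF f g] by (simp add: power2_sum)
  finally show ?thesis by (rule power2_le_imp_le) simp
qed

lemma L2_norm_triangle_diff:
  assumes "L2 a b f" "L2 a b g"
  shows "L2_norm a b (\<lambda>t. f t - g t) \<le> L2_norm a b f + L2_norm a b g"
  using L2_norm_triangle[OF assms(1) L2_minus[OF assms(2)]] by (simp add: L2_norm_minus)

lemma L2_norm_bounded:
  assumes "a \<le> b" "\<And>t. t \<in> {a..b} \<Longrightarrow> cmod (f t) \<le> c"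
  shows "L2_norm a b f \<le> c * sqrt (b - a)"
proof -
  have c: "0 \<le> c" using order_trans[OF norm_ge_zero assms(2)[of a]] assms(1) by simp
  have "L2_norm a b f \<le> L2_norm a b (\<lambda>t. complex_of_real c)"
    using assms c by (intro L2_norm_mono L2_continuous) auto
  also have "\<dots> = c * sqrt (b - a)"
    unfolding L2_norm_def using assms(1) c
    by (simp add: set_lebesgue_integral_def real_sqrt_mult)
  finally show ?thesis .
qed

lemma L2_norm_zero [simp]: "L2_norm a b (\<lambda>t. 0) = 0"
  unfolding L2_norm_eq by simp

section \<open>Density of trigonometric polynomials\<close>

inductive trig_poly :: "(real \<Rightarrow> complex) \<Rightarrow> bool" where
  zero: "trig_poly (\<lambda>t. 0)"
| step: "trig_poly f \<Longrightarrow> trig_poly (\<lambda>t. f t + c * cis (of_int k * t))"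

lemma trig_poly_add: "trig_poly g \<Longrightarrow> trig_poly f \<Longrightarrow> trig_poly (\<lambda>t. f t + g t)"
proof (induction rule: trig_poly.induct)
  case (step g c k)
  then show ?case using trig_poly.step[of "\<lambda>t. f t + g t" c k] by (simp add: add.assoc)
qed simp

lemma trig_poly_monom: "trig_poly (\<lambda>t. c * cis (of_int k * t))"
  using trig_poly.step[OF trig_poly.zero, of c k] by simp

lemma trig_poly_monom_mult: "trig_poly f \<Longrightarrow> trig_poly (\<lambda>t. c * cis (of_int k * t) * f t)"
proof (induction rule: trig_poly.induct)
  case (step g d l)
  have "c * cis (of_int k * t) * (g t + d * cis (of_int l * t)) =
      c * cis (of_int k * t) * g t + (c * d) * cis (of_int (k + l) * t)" for t
    by (simp add: algebra_simps cis_mult)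
  then show ?case using trig_poly.step[OF step.IH, of "c * d" "k + l"] by simp
qed (use trig_poly.zero in simp)

lemma trig_poly_mult: "trig_poly g \<Longrightarrow> trig_poly f \<Longrightarrow> trig_poly (\<lambda>t. g t * f t)"
proof (induction rule: trig_poly.induct)
  case (step g d l)
  have "(g t + d * cis (of_int l * t)) * f t = g t * f t + d * cis (of_int l * t) * f t" for t
    by (simp add: algebra_simps)
  then show ?case using trig_poly_add[OF trig_poly_monom_mult[OF step.prems, of d l] step.IH[OF step.prems]]
    by simp
qed (use trig_poly.zero in simp)

lemma trig_poly_const: "trig_poly (\<lambda>t. c)"
  using trig_poly_monom[of c 0] by simp

text \<open>A real-linear \<open>f\<close> on the plane is determined by \<open>f 1\<close> and
  \<open>f \<i>\<close>, and Euler's formulas turn it into a combination of the exponentials with k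
  = 1 and k = -1; sums and products are closure properties.\<close>

lemma trig_poly_real_polynomial_function:
  fixes q :: "complex \<Rightarrow> real"
  shows "real_polynomial_function q \<Longrightarrow> trig_poly (\<lambda>t. complex_of_real (q (cis t)))"
proof (induction rule: real_polynomial_function.induct)
  case (linear f)
  then interpret bounded_linear f .
  have "complex_of_real (f (cis t)) =
      (complex_of_real (f 1) / 2 - \<i> * complex_of_real (f \<i>) / 2) * cis (of_int 1 * t) +
      (complex_of_real (f 1) / 2 + \<i> * complex_of_real (f \<i>) / 2) * cis (of_int (-1) * t)" for t
  proof -
    have "cis t = cos t *\<^sub>R 1 + sin t *\<^sub>R \<i>" by (simp add: complex_eq_iff)
    then have "f (cis t) = cos t * f 1 + sin t * f \<i>" by (simp only: add scaleR real_scaleR_def)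
    then show ?thesis by (simp add: complex_eq_iff algebra_simps)
  qed
  then show ?case by (simp only: trig_poly_add trig_poly_monom)
next
  case (const c)
  then show ?case by (rule trig_poly_const)
next
  case (add f g)
  then show ?case using trig_poly_add[OF add.IH(2) add.IH(1)] by simp
next
  case (mult f g)
  then show ?case using trig_poly_mult[OF mult.IH(1) mult.IH(2)] by simp
qed

lemma trig_poly_polynomial_function:
  fixes g :: "complex \<Rightarrow> complex"
  assumes "polynomial_function g"
  shows "trig_poly (\<lambda>t. g (cis t))"
proof -
  have "real_polynomial_function (Re \<circ> g)" "real_polynomial_function (Im \<circ> g)"
    using assms bounded_linear_Re bounded_linear_Im unfolding polynomial_function_def by blast+
  note * = this[THEN trig_poly_real_polynomial_function]
  have "g (cis t) = complex_of_real ((Re \<circ> g) (cis t)) + \<i> * complex_of_real ((Im \<circ> g) (cis t))" for t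
    by (simp add: complex_eq_iff)
  then show ?thesis
    using trig_poly_add[OF trig_poly_mult[OF trig_poly_const[of \<i>] *(2)] *(1)] by simp
qed

lemma trig_poly_uniform_approx:
  fixes h :: "real \<Rightarrow> complex"
  assumes cont: "continuous_on {0..2 * pi} h" and per: "h 0 = h (2 * pi)" and e: "e > 0"
  obtains p where "trig_poly p" "\<And>t. t \<in> {0..2 * pi} \<Longrightarrow> cmod (h t - p t) < e"
proof -
  define q where "q = (\<lambda>s. h (2 * pi * s))"
  have "path q" unfolding path_def q_def
    by (rule continuous_on_compose2[OF cont]) (auto intro!: continuous_intros)
  moreover have "pathfinish q = pathstart q"
    by (simp add: pathfinish_def pathstart_def q_def per)
  ultimately have "homotopic_loops UNIV q q" by (simp add: homotopic_loops_refl)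
  \<comment> \<open>a closed path descends to a continuous function on the circle\<close>
  then have "continuous_on (sphere 0 1) (q \<circ> (\<lambda>z. Arg2pi z / (2 * pi)))"
    by (intro homotopic_with_imp_continuous[THEN conjunct1, OF homotopic_loops_imp_homotopic_circlemaps])
  from Stone_Weierstrass_polynomial_function[OF compact_sphere this e]
  obtain g where g: "polynomial_function g"
    and approx: "\<And>z. z \<in> sphere 0 1 \<Longrightarrow> cmod ((q \<circ> (\<lambda>z. Arg2pi z / (2 * pi))) z - g z) < e"
    by metis
  show ?thesis
  proof (rule that)
    show "trig_poly (\<lambda>t. g (cis t))" using g by (rule trig_poly_polynomial_function)
    fix t assume t: "t \<in> {0..2 * pi}"
    have "(q \<circ> (\<lambda>z. Arg2pi z / (2 * pi))) (cis t) = h t"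
    \<comment> \<open>\<open>Arg2pi\<close> takes values in [0, 2\<pi>), so the right endpoint is
      sent to 0 and only periodicity of \<open>h\<close> recovers its value there.\<close>
    proof (cases "t = 2 * pi")
      case True
      have "Arg2pi 1 = 0" by (rule Arg2pi_unique[of 1]) auto
      then show ?thesis using True per by (simp add: q_def)
    next
      case False
      then have "Arg2pi (cis t) = t" using t
        by (intro Arg2pi_unique[of 1]) (auto simp: cis_conv_exp)
      then show ?thesis by (simp add: q_def)
    qed
    then show "cmod (h t - g (cis t)) < e" using approx[of "cis t"] by simp
  qed
qed

lemma trig_poly_continuous: "trig_poly p \<Longrightarrow> continuous_on S p"
proof (induction rule: trig_poly.induct)
  case (step f c k)
  then show ?case by (auto simp: cis_conv_exp intro!: continuous_intros)
qed simp

section \<open>Approximation of square integrable functions by continuous periodic ones\<close>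

lemma L2_norm_dominated_tendsto:
  assumes meas: "\<And>n. F n \<in> borel_measurable (restrict_space lborel {a..b})"
    and g: "g \<in> borel_measurable (restrict_space lborel {a..b})"
    and lim: "AE t in restrict_space lborel {a..b}. (\<lambda>n. F n t) \<longlonglongrightarrow> g t"
    and W: "integrable (restrict_space lborel {a..b}) W"
    and dom: "\<And>n. AE t in restrict_space lborel {a..b}. (cmod (g t - F n t))^2 \<le> W t"
  shows "(\<lambda>n. L2_norm a b (\<lambda>t. g t - F n t)) \<longlonglongrightarrow> 0"
proof -
  let ?M = "restrict_space lborel {a..b}"
  note [measurable] = meas g
  have "(\<lambda>n. \<integral>t. (cmod (g t - F n t))^2 \<partial>?M) \<longlonglongrightarrow> (\<integral>t. 0 \<partial>?M)"
  proof (rule integral_dominated_convergence[where w=W])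
    show "AE t in ?M. (\<lambda>n. (cmod (g t - F n t))^2) \<longlonglongrightarrow> 0"
      using lim
    proof eventually_elim
      case (elim t)
      have "(\<lambda>n. (cmod (g t - F n t))^2) \<longlonglongrightarrow> (cmod (g t - g t))^2"
        by (intro tendsto_intros elim)
      then show ?case by simp
    qed
    show "AE t in ?M. norm ((cmod (g t - F n t))^2) \<le> W t" for n
      using dom[of n] by eventually_elim simp
  qed (use W in measurable)
  then have "(\<lambda>n. sqrt (\<integral>t. (cmod (g t - F n t))^2 \<partial>?M)) \<longlonglongrightarrow> sqrt 0"
    by (intro tendsto_real_sqrt) simp
  then show ?thesis unfolding L2_norm_eq by simp
qed

lemma L2_truncation:
  assumes g: "L2 a b g" and e: "e > 0"
  obtains n :: nat where "L2_norm a b (\<lambda>t. g t - (if cmod (g t) \<le> real n then g t else 0)) < e"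
proof -
  let ?M = "restrict_space lborel {a..b}"
  let ?F = "\<lambda>n t. if cmod (g t) \<le> real n then g t else 0"
  note [measurable] = L2_measurable[OF g]
  have "(\<lambda>n. L2_norm a b (\<lambda>t. g t - ?F n t)) \<longlonglongrightarrow> 0"
  proof (rule L2_norm_dominated_tendsto[OF _ _ _ L2_integrable_square[OF g]])
    show "AE t in ?M. (\<lambda>n. ?F n t) \<longlonglongrightarrow> g t"
    proof (rule AE_I2)
      fix t
      obtain N :: nat where "cmod (g t) \<le> real N" using real_arch_simple by blast
      then have "\<forall>\<^sub>F n in sequentially. ?F n t = g t"
        unfolding eventually_sequentially by (intro exI[of _ N]) auto
      then show "(\<lambda>n. ?F n t) \<longlonglongrightarrow> g t" by (rule tendsto_eventually)
    qed
  qed auto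
  then have "\<forall>\<^sub>F n in sequentially. L2_norm a b (\<lambda>t. g t - ?F n t) < e"
    using e by (rule order_tendstoD)
  then show ?thesis using that by (auto simp: eventually_sequentially)
qed

text \<open>The radial retraction onto the closed disc of radius B. It is continuous and fixes the
  disc, so it makes continuous approximants of a function bounded by B uniformly bounded without
  disturbing their limit.\<close>

definition clip :: "real \<Rightarrow> complex \<Rightarrow> complex" where
  "clip B z = complex_of_real (B / max B (cmod z)) * z"

lemma clip_eq: "B > 0 \<Longrightarrow> cmod z \<le> B \<Longrightarrow> clip B z = z"
  by (simp add: clip_def max_def)

lemma norm_clip_le: "B > 0 \<Longrightarrow> cmod (clip B z) \<le> B"
proof -
  assume B: "B > 0"
  have "B * cmod z \<le> B * max B (cmod z)" using B by (intro mult_left_mono) auto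
  moreover have "0 < max B (cmod z)" using B by auto
  ultimately have "B / max B (cmod z) * cmod z \<le> B" by (simp add: pos_divide_le_eq)
  moreover have "\<bar>B / max B (cmod z)\<bar> = B / max B (cmod z)" using B by auto
  ultimately show ?thesis unfolding clip_def norm_mult norm_of_real by simp
qed

lemma continuous_on_clip: "B > 0 \<Longrightarrow> continuous_on S (clip B)"
  unfolding clip_def by (intro continuous_intros) auto

text \<open>A trapezoid with slopes of size n at both ends. It forces approximants to vanish at 0
  and 2\<pi>, hence to be periodic, and is eventually 1 at each interior point.\<close>

definition edge_cutoff :: "nat \<Rightarrow> real \<Rightarrow> real" where
  "edge_cutoff n t = max 0 (min 1 (real n * min t (2 * pi - t)))"

lemma edge_cutoff_bounds: "0 \<le> edge_cutoff n t" "edge_cutoff n t \<le> 1"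
  by (auto simp: edge_cutoff_def)

lemma edge_cutoff_ends: "edge_cutoff n 0 = 0" "edge_cutoff n (2 * pi) = 0"
  by (auto simp: edge_cutoff_def)

lemma continuous_on_edge_cutoff: "continuous_on S (edge_cutoff n)"
  unfolding edge_cutoff_def by (intro continuous_intros)

lemma edge_cutoff_eventually: "0 < t \<Longrightarrow> t < 2 * pi \<Longrightarrow> \<forall>\<^sub>F n in sequentially. edge_cutoff n t = 1"
proof -
  assume "0 < t" "t < 2 * pi"
  then have m: "0 < min t (2 * pi - t)" by simp
  obtain N :: nat where N: "1 / min t (2 * pi - t) \<le> real N" using real_arch_simple by blast
  show "\<forall>\<^sub>F n in sequentially. edge_cutoff n t = 1"
    using eventually_ge_at_top[of N]
  proof eventually_elim
    case (elim n)
    then have "1 / min t (2 * pi - t) \<le> real n" using N by (meson of_nat_le_iff order_trans)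
    then have "1 \<le> real n * min t (2 * pi - t)" using m by (simp add: pos_divide_le_eq)
    then show ?case by (simp add: edge_cutoff_def)
  qed
qed

text \<open>A Lebesgue measurable function is a limit of continuous functions off a negligible set.
  Clipping and cutting off keep these continuous, bounded by B and zero at the endpoints, so
  dominated convergence applies with a constant majorant.\<close>

lemma bounded_continuous_approx:
  assumes meas: "g \<in> borel_measurable (restrict_space lborel {0..2 * pi})"
    and bound: "\<And>t. cmod (g t) \<le> B" and B: "B > 0" and e: "e > 0"
  obtains h where "continuous_on UNIV h" "h 0 = 0" "h (2 * pi) = 0"
    "L2_norm 0 (2 * pi) (\<lambda>t. g t - h t) < e"
proof -
  let ?M = "restrict_space lborel {0..2 * pi}"
  define G where "G = (\<lambda>t. indicator {0..2 * pi} t *\<^sub>R g t)"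
  have "G \<in> borel_measurable lborel"
    using meas unfolding G_def by (subst (asm) borel_measurable_restrict_space_iff) auto
  then have "G \<in> borel_measurable lebesgue" by (rule measurable_completion)
  then have "G measurable_on UNIV" by (intro lebesgue_measurable_imp_measurable_on) auto
  then obtain N u where N: "negligible N" and u: "\<And>n. continuous_on UNIV (u n)"
    and lim: "\<And>x. x \<notin> N \<Longrightarrow> (\<lambda>n. u n x) \<longlonglongrightarrow> G x"
    unfolding measurable_on_def by auto
  define h where "h = (\<lambda>n t. complex_of_real (edge_cutoff n t) * clip B (u n t))"
  have cont_h: "continuous_on UNIV (h n)" for n
    unfolding h_def
    by (intro continuous_intros continuous_on_edge_cutoff
        continuous_on_compose2[OF continuous_on_clip[OF B, of UNIV] u]) auto
  have h_le: "cmod (h n t) \<le> B" for n t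
    using mult_mono[OF edge_cutoff_bounds(2)[of n t] norm_clip_le[OF B, of "u n t"]]
      edge_cutoff_bounds(1)[of n t]
    by (simp add: h_def norm_mult)
  have G: "(\<lambda>n. h n t) \<longlonglongrightarrow> g t" if "t \<notin> N" "0 < t" "t < 2 * pi" for t
  proof -
    have Gt: "G t = g t" using that by (simp add: G_def)
    have "isCont (clip B) (G t)"
      using continuous_on_clip[OF B, of UNIV] by (simp add: continuous_on_eq_continuous_at)
    then have "(\<lambda>n. clip B (u n t)) \<longlonglongrightarrow> clip B (G t)"
      using lim[OF that(1)] by (rule isCont_tendsto_compose)
    then have 1: "(\<lambda>n. clip B (u n t)) \<longlonglongrightarrow> g t"
      using clip_eq[OF B bound] Gt by simp
    have 2: "(\<lambda>n. complex_of_real (edge_cutoff n t)) \<longlonglongrightarrow> 1"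
      using edge_cutoff_eventually[OF that(2,3)] by (intro tendsto_eventually) (auto elim: eventually_mono)
    show ?thesis using tendsto_mult[OF 2 1] by (simp add: h_def)
  qed
  have ae: "AE t in ?M. (\<lambda>n. h n t) \<longlonglongrightarrow> g t"
  proof -
    \<comment> \<open>The endpoints join the exceptional set because the cutoff is 0 there for every
      n.\<close>
    have "negligible (N \<union> {0, 2 * pi})" using N by (intro negligible_Un) auto
    then have "N \<union> {0, 2 * pi} \<in> null_sets lebesgue" by (simp add: negligible_iff_null_sets)
    then have "AE t in lebesgue. t \<in> {0..2 * pi} \<longrightarrow> (\<lambda>n. h n t) \<longlonglongrightarrow> g t"
    proof (rule AE_I')
      show "{t \<in> space lebesgue. \<not> (t \<in> {0..2 * pi} \<longrightarrow> (\<lambda>n. h n t) \<longlonglongrightarrow> g t)} \<subseteq> N \<union> {0, 2 * pi}"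
        using G by force
    qed
    then have "AE t in lborel. t \<in> {0..2 * pi} \<longrightarrow> (\<lambda>n. h n t) \<longlonglongrightarrow> g t"
      by (simp only: AE_completion_iff)
    then show ?thesis by (subst AE_restrict_space_iff) auto
  qed
  interpret finite_measure ?M by (rule finite_measure_Icc)
  have "(\<lambda>n. L2_norm 0 (2 * pi) (\<lambda>t. g t - h n t)) \<longlonglongrightarrow> 0"
  proof (rule L2_norm_dominated_tendsto[OF L2_measurable[OF L2_continuous] meas ae])
    show "continuous_on {0..2 * pi} (h n)" for n using cont_h continuous_on_subset by blast
    show "AE t in ?M. (cmod (g t - h n t))^2 \<le> (2 * B)^2" for n
    proof (intro AE_I2 power_mono)
      show "cmod (g t - h n t) \<le> 2 * B" for t
        using norm_triangle_ineq4[of "g t" "h n t"] bound[of t] h_le[of n t] by linarith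
    qed simp
  qed simp
  then have "\<forall>\<^sub>F n in sequentially. L2_norm 0 (2 * pi) (\<lambda>t. g t - h n t) < e"
    using e by (rule order_tendstoD)
  then obtain n where "L2_norm 0 (2 * pi) (\<lambda>t. g t - h n t) < e" by (auto simp: eventually_sequentially)
  moreover have "h n 0 = 0" "h n (2 * pi) = 0" by (simp_all add: h_def edge_cutoff_ends)
  ultimately show ?thesis using that cont_h by blast
qed

lemma trig_poly_L2_dense:
  assumes g: "L2 0 (2 * pi) g" and e: "e > 0"
  obtains p where "trig_poly p" "L2_norm 0 (2 * pi) (\<lambda>t. g t - p t) < e"
proof -
  obtain n where n: "L2_norm 0 (2 * pi) (\<lambda>t. g t - (if cmod (g t) \<le> real n then g t else 0)) < e / 3"
    using L2_truncation[OF g, of "e / 3"] e by auto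
  define g1 where "g1 = (\<lambda>t. if cmod (g t) \<le> real n then g t else 0)"
  have n': "L2_norm 0 (2 * pi) (\<lambda>t. g t - g1 t) < e / 3" using n by (simp add: g1_def)
  note [measurable] = L2_measurable[OF g]
  have g1_meas: "g1 \<in> borel_measurable (restrict_space lborel {0..2 * pi})"
    unfolding g1_def by measurable
  have g1_le: "cmod (g1 t) \<le> real n + 1" for t by (simp add: g1_def)
  obtain h where h: "continuous_on UNIV h" "h 0 = 0" "h (2 * pi) = 0"
    "L2_norm 0 (2 * pi) (\<lambda>t. g1 t - h t) < e / 3"
    using bounded_continuous_approx[OF g1_meas g1_le, of "e / 3"] e by auto
  \<comment> \<open>A uniform error of at most d costs at most e / 6 in L2 norm, strictly below the
    e / 3 allotted to this step.\<close>
  define d where "d = e / (6 * sqrt (2 * pi))"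
  have d: "d > 0" using e by (simp add: d_def)
  have hc: "continuous_on {0..2 * pi} h" using h(1) continuous_on_subset by blast
  obtain p where p: "trig_poly p" "\<And>t. t \<in> {0..2 * pi} \<Longrightarrow> cmod (h t - p t) < d"
    using trig_poly_uniform_approx[OF hc _ d] h(2,3) by auto
  have L2s: "L2 0 (2 * pi) g1" "L2 0 (2 * pi) h" "L2 0 (2 * pi) p"
    using L2_bounded[OF g1_meas g1_le] L2_continuous[OF hc]
      L2_continuous[OF trig_poly_continuous[OF p(1)]] by blast+
  have "L2_norm 0 (2 * pi) (\<lambda>t. h t - p t) \<le> d * sqrt (2 * pi - 0)"
    using p(2) by (intro L2_norm_bounded) (auto intro: less_imp_le)
  also have "\<dots> = e / 6" by (simp add: d_def)
  finally have 3: "L2_norm 0 (2 * pi) (\<lambda>t. h t - p t) < e / 3" using e by simp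
  have "L2_norm 0 (2 * pi) (\<lambda>t. (g t - g1 t) + ((g1 t - h t) + (h t - p t)))
      \<le> L2_norm 0 (2 * pi) (\<lambda>t. g t - g1 t) + L2_norm 0 (2 * pi) (\<lambda>t. (g1 t - h t) + (h t - p t))"
    by (intro L2_norm_triangle L2_add L2_diff g L2s)
  also have "L2_norm 0 (2 * pi) (\<lambda>t. (g1 t - h t) + (h t - p t))
      \<le> L2_norm 0 (2 * pi) (\<lambda>t. g1 t - h t) + L2_norm 0 (2 * pi) (\<lambda>t. h t - p t)"
    by (intro L2_norm_triangle L2_diff L2s)
  finally have "L2_norm 0 (2 * pi) (\<lambda>t. g t - p t) < e"
    using n' h(4) 3 by simp
  then show ?thesis using that p(1) by blast
qed

section \<open>Orthonormal bases\<close>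

lemma L2_inner_add_right:
  assumes "L2 a b f" "L2 a b g" "L2 a b h"
  shows "L2_inner a b h (\<lambda>t. f t + g t) = L2_inner a b h f + L2_inner a b h g"
  using L2_inner_add_left[OF assms] L2_inner_commute[of a b h] by simp

lemma L2_inner_sum_scale_right:
  assumes "\<And>i. i \<in> A \<Longrightarrow> L2 a b (f i)" "L2 a b h"
  shows "L2_inner a b h (\<lambda>t. \<Sum>i\<in>A. c i * f i t) = (\<Sum>i\<in>A. cnj (c i) * L2_inner a b h (f i))"
proof -
  have "L2_inner a b (\<lambda>t. \<Sum>i\<in>A. c i * f i t) h = (\<Sum>i\<in>A. c i * L2_inner a b (f i) h)"
    by (subst L2_inner_sum_left) (simp_all add: assms L2_scale L2_inner_scale_left)
  then show ?thesis
    unfolding L2_inner_commute[of a b h] by simp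
qed

lemma L2_Pythagoras:
  assumes "L2 a b f" "L2 a b g" "L2_inner a b f g = 0"
  shows "(L2_norm a b (\<lambda>t. f t + g t))^2 = (L2_norm a b f)^2 + (L2_norm a b g)^2"
proof -
  have "L2_inner a b g f = 0" using assms(3) L2_inner_commute[of a b g f] by simp
  then have "L2_inner a b (\<lambda>t. f t + g t) (\<lambda>t. f t + g t) = L2_inner a b f f + L2_inner a b g g"
    using assms(3) by (simp only: L2_inner_add_left[OF assms(1,2) L2_add[OF assms(1,2)]]
        L2_inner_add_right[OF assms(1,2,1)] L2_inner_add_right[OF assms(1,2,2)] add_0_left add_0_right)
  then have "complex_of_real ((L2_norm a b (\<lambda>t. f t + g t))^2) =
      complex_of_real ((L2_norm a b f)^2 + (L2_norm a b g)^2)"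
    unfolding L2_inner_self of_real_add .
  then show ?thesis by (simp only: of_real_eq_iff)
qed

lemma L2_inner_FTC:
  assumes "a \<le> b" "continuous_on {a..b} f" "continuous_on {a..b} g"
    and "\<And>t. t \<in> {a..b} \<Longrightarrow> (F has_vector_derivative f t * cnj (g t)) (at t within {a..b})"
  shows "L2_inner a b f g = F b - F a"
  unfolding L2_inner_def set_lebesgue_integral_def
  by (rule integral_FTC_Icc) (use assms in \<open>auto intro!: continuous_intros\<close>)

text \<open>Completeness is required only as approximability, with coefficients \<open>c\<close>
  that may depend on \<epsilon>; \<open>best_approximation\<close> upgrades this to convergence of
  the Fourier expansion.\<close>

locale L2_onb =
  fixes a b :: real and e :: "nat \<Rightarrow> real \<Rightarrow> complex"
  assumes a_le_b: "a \<le> b"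
    and L2_e: "L2 a b (e i)"
    and orthonormal: "L2_inner a b (e i) (e j) = (if i = j then 1 else 0)"
    and span_dense: "L2 a b g \<Longrightarrow> \<epsilon> > 0 \<Longrightarrow>
      \<exists>N c. \<forall>n\<ge>N. L2_norm a b (\<lambda>t. g t - (\<Sum>i<n. c i * e i t)) < \<epsilon>"
begin

abbreviation "coef g i \<equiv> L2_inner a b g (e i)"

lemma L2_comb: "L2 a b (\<lambda>t. \<Sum>i\<in>A. c i * e i t)"
  by (intro L2_sum L2_scale L2_e)

lemma coef_comb: "coef (\<lambda>t. \<Sum>i<n. c i * e i t) j = (if j < n then c j else 0)"
  by (subst L2_inner_sum_left)
     (simp_all add: L2_e L2_scale L2_inner_scale_left orthonormal if_distrib[of "\<lambda>x. _ * x"] sum.delta cong: if_cong)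

lemma norm_comb: "(L2_norm a b (\<lambda>t. \<Sum>i<n. c i * e i t))^2 = (\<Sum>i<n. (cmod (c i))^2)"
proof -
  have "complex_of_real ((L2_norm a b (\<lambda>t. \<Sum>i<n. c i * e i t))^2) =
      (\<Sum>i<n. cnj (c i) * coef (\<lambda>t. \<Sum>i<n. c i * e i t) i)"
    unfolding L2_inner_self[symmetric] by (intro L2_inner_sum_scale_right L2_e L2_comb)
  also have "\<dots> = complex_of_real (\<Sum>i<n. (cmod (c i))^2)"
    unfolding coef_comb of_real_sum by (intro sum.cong) (auto simp: complex_norm_square mult.commute simp del: of_real_power)
  finally show ?thesis by (simp only: of_real_eq_iff)
qed

lemma norm_e: "L2_norm a b (e i) = 1"
  using L2_inner_self[of a b "e i"] orthonormal[of i i]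
  by (metis L2_norm_nonneg of_real_eq_1_iff power2_eq_1_iff neg_0_le_iff_le not_one_le_zero)

lemma residual_orthogonal:
  assumes "L2 a b g"
  shows "L2_inner a b (\<lambda>t. g t - (\<Sum>i<n. coef g i * e i t)) (\<lambda>t. \<Sum>i<n. c i * e i t) = 0"
proof -
  have "coef (\<lambda>t. g t - (\<Sum>i<n. coef g i * e i t)) j = 0" if "j < n" for j
    using that by (subst L2_inner_diff_left) (simp_all add: assms L2_comb L2_e coef_comb)
  then show ?thesis
    by (subst L2_inner_sum_scale_right) (auto intro!: sum.neutral L2_e L2_diff assms L2_comb)
qed

text \<open>Changing the coefficients adds a vector of the span, to which the residual is
  orthogonal, so Pythagoras shows that the error can only grow.\<close>

lemma best_approximation:
  assumes "L2 a b g"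
  shows "L2_norm a b (\<lambda>t. g t - (\<Sum>i<n. coef g i * e i t)) \<le> L2_norm a b (\<lambda>t. g t - (\<Sum>i<n. c i * e i t))"
proof (rule power2_le_imp_le)
  have "(L2_norm a b (\<lambda>t. (g t - (\<Sum>i<n. coef g i * e i t)) + (\<Sum>i<n. (coef g i - c i) * e i t)))^2 =
     (L2_norm a b (\<lambda>t. g t - (\<Sum>i<n. coef g i * e i t)))^2 +
     (L2_norm a b (\<lambda>t. \<Sum>i<n. (coef g i - c i) * e i t))^2"
    by (intro L2_Pythagoras residual_orthogonal L2_diff L2_comb assms)
  then show "(L2_norm a b (\<lambda>t. g t - (\<Sum>i<n. coef g i * e i t)))^2
      \<le> (L2_norm a b (\<lambda>t. g t - (\<Sum>i<n. c i * e i t)))^2"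
    by (simp add: left_diff_distrib sum_subtractf)
qed simp

lemma expansion_tendsto:
  assumes "L2 a b g"
  shows "(\<lambda>n. L2_norm a b (\<lambda>t. g t - (\<Sum>i<n. coef g i * e i t))) \<longlonglongrightarrow> 0"
proof (rule LIMSEQ_I)
  fix \<epsilon> :: real assume "\<epsilon> > 0"
  from span_dense[OF assms this] obtain N c
    where "\<forall>n\<ge>N. L2_norm a b (\<lambda>t. g t - (\<Sum>i<n. c i * e i t)) < \<epsilon>" by blast
  then have "norm (L2_norm a b (\<lambda>t. g t - (\<Sum>i<n. coef g i * e i t)) - 0) < \<epsilon>" if "n \<ge> N" for n
    using best_approximation[OF assms, of n c] that by (auto intro: le_less_trans)
  then show "\<exists>N. \<forall>n\<ge>N. norm (L2_norm a b (\<lambda>t. g t - (\<Sum>i<n. coef g i * e i t)) - 0) < \<epsilon>"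
    by blast
qed

lemma coef_zero_imp_norm_zero:
  assumes "L2 a b g" "\<And>i. coef g i = 0"
  shows "L2_norm a b g = 0"
  using expansion_tendsto[OF assms(1)] assms(2) by (simp add: LIMSEQ_const_iff)

lemma Bessel_finite:
  assumes "L2 a b g"
  shows "(\<Sum>i<n. (cmod (coef g i))^2) \<le> (L2_norm a b g)^2"
proof -
  have "(L2_norm a b (\<lambda>t. (g t - (\<Sum>i<n. coef g i * e i t)) + (\<Sum>i<n. coef g i * e i t)))^2 =
     (L2_norm a b (\<lambda>t. g t - (\<Sum>i<n. coef g i * e i t)))^2 +
     (L2_norm a b (\<lambda>t. \<Sum>i<n. coef g i * e i t))^2"
    by (intro L2_Pythagoras residual_orthogonal L2_diff L2_comb assms)
  then show ?thesis unfolding norm_comb by simp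
qed

end

text \<open>The normalised exponentials, with integer frequencies in the order 0, -1, 1, -2, ... of
  \<open>int_decode\<close>. Odd n have negative frequency, and the sign (-1)^n compensates: it
  makes \<open>sin_op\<close> send each member to the sine of a positive frequency.\<close>

definition fourier :: "nat \<Rightarrow> real \<Rightarrow> complex" where
  "fourier n t = ((-1)^n / complex_of_real (sqrt (2 * pi))) * cis (of_int (int_decode n) * t)"

lemma continuous_on_fourier: "continuous_on S (fourier n)"
  unfolding fourier_def cis_conv_exp by (intro continuous_intros)

lemma fourier_inner:
  "L2_inner 0 (2 * pi) (fourier i) (fourier j) = (if i = j then 1 else 0)"
proof -
  define k where "k = int_decode i - int_decode j"
  have prod: "fourier i t * cnj (fourier j t) = (-1)^i * (-1)^j / (2 * pi) * cis (of_int k * t)" for t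
  proof -
    have "complex_of_real (sqrt (2 * pi)) * complex_of_real (sqrt (2 * pi)) = 2 * pi"
      by (simp flip: of_real_mult)
    then show ?thesis
      by (simp add: fourier_def k_def cis_cnj cis_mult left_diff_distrib mult.assoc[symmetric]
          times_divide_times_eq)
  qed
  show ?thesis
  proof (cases "i = j")
    case True
    then have "k = 0" by (simp add: k_def)
    have "L2_inner 0 (2 * pi) (fourier i) (fourier j) =
        complex_of_real (2 * pi) / (2 * pi) - complex_of_real 0 / (2 * pi)"
    proof (rule L2_inner_FTC[OF _ continuous_on_fourier continuous_on_fourier])
      show "((\<lambda>t. complex_of_real t / (2 * pi)) has_vector_derivative fourier i t * cnj (fourier j t))
          (at t within {0..2 * pi})" for t
        unfolding prod \<open>k = 0\<close> using True
        by (auto intro!: derivative_eq_intros simp: power_mult_distrib[symmetric])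
    qed simp
    then show ?thesis using True by simp
  next
    case False
    then have k: "k \<noteq> 0" unfolding k_def by (metis int_decode_eq right_minus_eq)
    let ?F = "\<lambda>t. (-1)^i * (-1)^j / (2 * pi) * (cis (of_int k * t) / (\<i> * of_int k))"
    have "L2_inner 0 (2 * pi) (fourier i) (fourier j) = ?F (2 * pi) - ?F 0"
    proof (rule L2_inner_FTC[OF _ continuous_on_fourier continuous_on_fourier])
      fix t
      have "((\<lambda>t. cis (of_int k * t)) has_vector_derivative (\<i> * of_int k) * cis (of_int k * t))
          (at t within {0..2 * pi})"
      proof -
        have "((\<lambda>z. exp (\<i> * (of_int k * z))) has_field_derivative
            (\<i> * of_int k) * exp (\<i> * (of_int k * of_real t))) (at (of_real t))"
          by (auto intro!: derivative_eq_intros)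
        from has_vector_derivative_real_field[OF this] show ?thesis
          by (simp add: cis_conv_exp)
      qed
      then show "(?F has_vector_derivative fourier i t * cnj (fourier j t)) (at t within {0..2 * pi})"
        unfolding prod using k by (auto intro!: derivative_eq_intros)
    qed simp
    moreover have "cis (of_int k * (2 * pi)) = 1"
      using cis_multiple_2pi[of "of_int k"] by (simp add: mult_ac)
    ultimately show ?thesis using False by simp
  qed
qed

lemma trig_poly_fourier_comb:
  "trig_poly p \<Longrightarrow> \<exists>N c. \<forall>n\<ge>N. p = (\<lambda>t. \<Sum>i<n. c i * fourier i t)"
proof (induction rule: trig_poly.induct)
  case zero
  then show ?case by (intro exI[of _ 0] exI[of _ "\<lambda>_. 0"]) simp
next
  case (step f d k)
  then obtain N c where N: "\<And>n. n \<ge> N \<Longrightarrow> f = (\<lambda>t. \<Sum>i<n. c i * fourier i t)" by blast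
  define j where "j = int_encode k"
  define s where "s = (-1)^j / complex_of_real (sqrt (2 * pi))"
  have s: "s \<noteq> 0" by (simp add: s_def)
  have "f t + d * cis (of_int k * t) = (\<Sum>i<n. (c i + (if i = j then d / s else 0)) * fourier i t)"
    if "n \<ge> max N (Suc j)" for n t
  proof -
    have "(\<Sum>i<n. (if i = j then d / s else 0) * fourier i t) = d / s * fourier j t"
      using that by (simp add: if_distrib[of "\<lambda>x. x * _"] sum.delta cong: if_cong)
    also have "\<dots> = d * cis (of_int k * t)"
    proof -
      have "fourier j t = s * cis (of_int k * t)" by (simp add: fourier_def s_def j_def)
      then show ?thesis using s by simp
    qed
    finally show ?thesis
      using fun_cong[OF N[of n], of t] that by (simp add: distrib_right sum.distrib)
  qed
  then show ?case by (intro exI[of _ "max N (Suc j)"] exI[of _ "\<lambda>i. c i + (if i = j then d / s else 0)"]) auto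
qed

interpretation fourier: L2_onb 0 "2 * pi" fourier
proof
  show "L2 0 (2 * pi) (fourier i)" for i by (intro L2_continuous continuous_on_fourier)
  show "L2_inner 0 (2 * pi) (fourier i) (fourier j) = (if i = j then 1 else 0)" for i j
    by (rule fourier_inner)
  fix g and \<epsilon> :: real
  assume "L2 0 (2 * pi) g" "\<epsilon> > 0"
  then obtain p where p: "trig_poly p" "L2_norm 0 (2 * pi) (\<lambda>t. g t - p t) < \<epsilon>"
    using trig_poly_L2_dense by blast
  obtain N c where "\<forall>n\<ge>N. p = (\<lambda>t. \<Sum>i<n. c i * fourier i t)"
    using trig_poly_fourier_comb[OF p(1)] by blast
  then have "L2_norm 0 (2 * pi) (\<lambda>t. g t - (\<Sum>i<n. c i * fourier i t)) < \<epsilon>" if "n \<ge> N" for n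
    using p(2) that by simp
  then show "\<exists>N c. \<forall>n\<ge>N. L2_norm 0 (2 * pi) (\<lambda>t. g t - (\<Sum>i<n. c i * fourier i t)) < \<epsilon>" by blast
qed simp

section \<open>Perturbation of isomorphisms\<close>

text \<open>Linearity is an equality of functions, not merely almost everywhere, but is asked only
  for square integrable arguments, since the operators contain integrals that need not be additive
  on other functions. \<open>L2_linear_projection\<close> later removes this restriction.\<close>

definition L2_linear :: "real \<Rightarrow> real \<Rightarrow> ((real \<Rightarrow> complex) \<Rightarrow> real \<Rightarrow> complex) \<Rightarrow> bool" where
  "L2_linear a b T \<longleftrightarrow> (\<forall>g. L2 a b g \<longrightarrow> L2 a b (T g)) \<and>
     (\<forall>g h \<alpha> \<beta>. L2 a b g \<longrightarrow> L2 a b h \<longrightarrow>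
        T (\<lambda>t. \<alpha> * g t + \<beta> * h t) = (\<lambda>t. \<alpha> * T g t + \<beta> * T h t))"

lemma L2_linear_L2: "L2_linear a b T \<Longrightarrow> L2 a b g \<Longrightarrow> L2 a b (T g)"
  unfolding L2_linear_def by simp

lemma L2_linear_comb:
  "L2_linear a b T \<Longrightarrow> L2 a b g \<Longrightarrow> L2 a b h \<Longrightarrow>
    T (\<lambda>t. \<alpha> * g t + \<beta> * h t) = (\<lambda>t. \<alpha> * T g t + \<beta> * T h t)"
  unfolding L2_linear_def by simp

lemma L2_linear_diff:
  "L2_linear a b T \<Longrightarrow> L2 a b g \<Longrightarrow> L2 a b h \<Longrightarrow> T (\<lambda>t. g t - h t) = (\<lambda>t. T g t - T h t)"
  using L2_linear_comb[of a b T g h 1 "-1"] by simp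

lemma L2_linear_scale:
  "L2_linear a b T \<Longrightarrow> L2 a b g \<Longrightarrow> T (\<lambda>t. c * g t) = (\<lambda>t. c * T g t)"
  using L2_linear_comb[of a b T g g c 0] by simp

lemma L2_linear_sum:
  assumes T: "L2_linear a b T" and f: "\<And>i::nat. L2 a b (f i)"
  shows "T (\<lambda>t. \<Sum>i<n. c i * f i t) = (\<lambda>t. \<Sum>i<n. c i * T (f i) t)"
proof (induction n)
  case 0
  show ?case using L2_linear_scale[OF T L2_zero, of 0] by simp
next
  case (Suc n)
  have "T (\<lambda>t. 1 * (\<Sum>i<n. c i * f i t) + c n * f n t) =
      (\<lambda>t. 1 * T (\<lambda>t. \<Sum>i<n. c i * f i t) t + c n * T (f n) t)"
    by (intro L2_linear_comb[OF T] L2_sum L2_scale f)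
  then show ?case using Suc.IH by simp
qed

lemma L2_linear_compose:
  assumes "L2_linear a b S" "L2_linear a b T"
  shows "L2_linear a b (\<lambda>g. S (T g))"
  using assms unfolding L2_linear_def by simp

definition L2_iso :: "real \<Rightarrow> real \<Rightarrow> ((real \<Rightarrow> complex) \<Rightarrow> real \<Rightarrow> complex) \<Rightarrow> bool" where
  "L2_iso a b T \<longleftrightarrow> L2_linear a b T \<and>
     (\<exists>C. \<forall>g. L2 a b g \<longrightarrow> L2_norm a b (T g) \<le> C * L2_norm a b g) \<and>
     (\<exists>D. \<forall>g. L2 a b g \<longrightarrow> L2_norm a b g \<le> D * L2_norm a b (T g)) \<and>
     (\<forall>h. L2 a b h \<longrightarrow> (\<exists>g. L2 a b g \<and> L2_norm a b (\<lambda>t. T g t - h t) = 0))"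

text \<open>Since \<open>L\<close> maps L2 into bounded functions, the series converges uniformly to
  a square integrable function. The equation is posed for the correction \<open>u\<close>, all of
  whose terms lie in the range of \<open>L\<close> up to sign, because \<open>h\<close> itself may
  be unbounded; \<open>h - u\<close> then solves x + L x = h.\<close>

lemma Neumann_series:
  assumes ab: "a \<le> b" and L: "L2_linear a b L"
    and q: "\<And>g t. L2 a b g \<Longrightarrow> t \<in> {a..b} \<Longrightarrow> cmod (L g t) \<le> q * L2_norm a b g"
    and q0: "0 \<le> q" and small: "q * sqrt (b - a) \<le> 1 / 2" and h: "L2 a b h"
  obtains u where "L2 a b u" "\<And>t. t \<in> {a..b} \<Longrightarrow> u t + L u t = L h t"
proof -
  \<comment> \<open>\<open>r k\<close> is (-L)^k applied to \<open>L h\<close>.\<close>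
  define r where "r = rec_nat (L h) (\<lambda>_ f t. - L f t)"
  have r0: "r 0 = L h" and rS: "r (Suc k) = (\<lambda>t. - L (r k) t)" for k
    by (simp_all add: r_def)
  define M where "M = q * L2_norm a b h"
  have M: "0 \<le> M" using q0 by (simp add: M_def)
  have L2r: "L2 a b (r k)" for k
  proof (induction k)
    case 0
    show ?case unfolding r0 by (rule L2_linear_L2[OF L h])
  next
    case (Suc k)
    then show ?case unfolding rS by (intro L2_minus L2_linear_L2[OF L])
  qed
  \<comment> \<open>A sup bound c on f gives the sup bound c / 2 on \<open>L f\<close>; this is the
    contraction that drives the series.\<close>
  have qb: "q * L2_norm a b f \<le> c / 2" if "\<And>t. t \<in> {a..b} \<Longrightarrow> cmod (f t) \<le> c" "0 \<le> c" for f c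
  proof -
    have "q * L2_norm a b f \<le> q * (c * sqrt (b - a))"
      by (intro mult_left_mono q0 L2_norm_bounded ab that)
    also have "\<dots> = c * (q * sqrt (b - a))" by simp
    also have "\<dots> \<le> c * (1 / 2)" by (intro mult_left_mono small that)
    finally show ?thesis by simp
  qed
  have r_le: "cmod (r k t) \<le> M * (1/2)^k" if "t \<in> {a..b}" for k t
    using that
  proof (induction k arbitrary: t)
    case 0
    then show ?case using q[OF h 0] by (simp add: r0 M_def)
  next
    case (Suc k)
    have "cmod (r (Suc k) t) \<le> q * L2_norm a b (r k)" using q[OF L2r Suc.prems] by (simp add: rS)
    also have "\<dots> \<le> M * (1/2)^k / 2" using M by (intro qb Suc.IH) auto
    finally show ?case by simp
  qed
  have geo: "summable (\<lambda>k. M * (1/2::real)^k)" by (intro summable_mult summable_geometric) simp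
  have summ: "summable (\<lambda>k. r k t)" if "t \<in> {a..b}" for t
    by (rule summable_comparison_test'[OF geo]) (use r_le that in auto)
  define u where "u = (\<lambda>t. \<Sum>k. r k t)"
  define s where "s = (\<lambda>n t. \<Sum>k<n. 1 * r k t)"
  have L2s: "L2 a b (s n)" for n unfolding s_def by (intro L2_sum L2_scale L2r)
  have lim: "(\<lambda>n. s n t) \<longlonglongrightarrow> u t" if "t \<in> {a..b}" for t
    using summable_LIMSEQ[OF summ[OF that]] by (simp add: s_def u_def)
  have u_s: "cmod (u t - s n t) \<le> M * 2 * (1/2)^n" if t: "t \<in> {a..b}" for n t
  proof -
    have "u t - s n t = (\<Sum>k. r (k + n) t)"
      using suminf_minus_initial_segment[OF summ[OF t], of n] by (simp add: u_def s_def)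
    also have "cmod \<dots> \<le> (\<Sum>k. M * (1/2)^n * (1/2)^k)"
    proof (rule norm_suminf_le)
      show "cmod (r (k + n) t) \<le> M * (1/2)^n * (1/2)^k" for k
        using r_le[OF t, of "k + n"] by (simp add: power_add mult_ac)
      show "summable (\<lambda>k. M * (1/2)^n * (1/2::real)^k)" by (intro summable_mult summable_geometric) simp
    qed
    also have "\<dots> = M * (1/2)^n * (\<Sum>k. (1/2)^k)"
      by (intro suminf_mult summable_geometric) simp
    finally show ?thesis by (simp add: suminf_geometric)
  qed
  have u: "L2 a b u"
  proof (rule L2_bounded)
    show "u \<in> borel_measurable (restrict_space lborel {a..b})"
      by (rule borel_measurable_LIMSEQ_metric[OF L2_measurable[OF L2s]])
        (use lim in \<open>simp add: space_restrict_space\<close>)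
    show "cmod (u t) \<le> M * 2" if "t \<in> {a..b}" for t
      using u_s[OF that, of 0] by (simp add: s_def)
  qed
  show ?thesis
  proof (rule that[OF u])
    fix t assume t: "t \<in> {a..b}"
    \<comment> \<open>Applying \<open>L\<close> shifts the series by one term. The limit of
      \<open>L (s n) t\<close> is now computed twice: from this identity, and from the sup bound on
      \<open>L (u - s n)\<close>.\<close>
    have "L (s n) t = L h t - s (Suc n) t" for n
    proof -
      have "L (s n) = (\<lambda>t. \<Sum>k<n. 1 * L (r k) t)" unfolding s_def by (rule L2_linear_sum[OF L L2r])
      moreover have "s (Suc n) t = r 0 t + (\<Sum>k<n. r (Suc k) t)"
        unfolding s_def by (simp only: sum.lessThan_Suc_shift mult_1)
      ultimately show ?thesis by (simp add: r0 rS sum_negf)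
    qed
    then have lim1: "(\<lambda>n. L (s n) t) \<longlonglongrightarrow> L h t - u t"
      using LIMSEQ_Suc[OF lim[OF t]] by (simp add: tendsto_diff)
    have "cmod (L u t - L (s n) t) \<le> M * (1/2)^n" for n
    proof -
      have "cmod (L u t - L (s n) t) = cmod (L (\<lambda>t. u t - s n t) t)"
        by (simp add: L2_linear_diff[OF L u L2s])
      also have "\<dots> \<le> q * L2_norm a b (\<lambda>t. u t - s n t)" by (intro q L2_diff u L2s t)
      also have "\<dots> \<le> M * 2 * (1/2)^n / 2" by (rule qb[OF u_s]) (use M in auto)
      finally show ?thesis by simp
    qed
    moreover have "(\<lambda>n. M * (1/2::real)^n) \<longlonglongrightarrow> 0"
      using tendsto_mult[OF tendsto_const LIMSEQ_realpow_zero[of "1/2::real"], of M] by simp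
    ultimately have "(\<lambda>n. L u t - L (s n) t) \<longlonglongrightarrow> 0"
      by (rule Lim_null_comparison[OF always_eventually[OF allI]])
    then have "(\<lambda>n. L (s n) t) \<longlonglongrightarrow> L u t"
      using tendsto_diff[OF tendsto_const[of "L u t"], of "\<lambda>n. L u t - L (s n) t" 0] by simp
    then have "L u t = L h t - u t" using lim1 LIMSEQ_unique by blast
    then show "u t + L u t = L h t" by simp
  qed
qed

text \<open>T0 + D = (1 + D S0) T0, and \<open>D S0\<close> has norm at most 1/2 because a sup bound
  costs a factor sqrt(b - a) in L2 norm.\<close>

lemma L2_iso_perturb:
  assumes ab: "a \<le> b" and T0: "L2_linear a b T0" and S0: "L2_linear a b S0" and D: "L2_linear a b D"
    and T0_le: "\<And>g. L2 a b g \<Longrightarrow> L2_norm a b (T0 g) \<le> c * L2_norm a b g"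
    and S0_le: "\<And>g. L2 a b g \<Longrightarrow> L2_norm a b (S0 g) \<le> s * L2_norm a b g" and s: "0 \<le> s"
    and TS: "\<And>g t. t \<in> {a..b} \<Longrightarrow> T0 (S0 g) t = g t"
    and ST: "\<And>g t. t \<in> {a..b} \<Longrightarrow> S0 (T0 g) t = g t"
    and D_le: "\<And>g t. L2 a b g \<Longrightarrow> t \<in> {a..b} \<Longrightarrow> cmod (D g t) \<le> \<eta> * L2_norm a b g" and \<eta>: "0 \<le> \<eta>"
    and small: "\<eta> * s * sqrt (b - a) \<le> 1 / 2"
  shows "L2_iso a b (\<lambda>g t. T0 g t + D g t)"
proof -
  note L2T0 = L2_linear_L2[OF T0] and L2S0 = L2_linear_L2[OF S0] and L2D = L2_linear_L2[OF D]
  have D_norm: "L2_norm a b (D g) \<le> \<eta> * sqrt (b - a) * L2_norm a b g" if "L2 a b g" for g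
    using L2_norm_bounded[OF ab D_le[OF that]] by (simp add: mult_ac)
  have lin: "L2_linear a b (\<lambda>g t. T0 g t + D g t)"
    using T0 D unfolding L2_linear_def by (auto intro!: L2_add simp: algebra_simps)
  moreover have "L2_norm a b (\<lambda>t. T0 g t + D g t) \<le> (c + \<eta> * sqrt (b - a)) * L2_norm a b g"
    if g: "L2 a b g" for g
    using L2_norm_triangle[OF L2T0[OF g] L2D[OF g]] T0_le[OF g] D_norm[OF g] by (simp add: distrib_right)
  \<comment> \<open>The chain below ends with half the norm of g on the right; absorbing it on the
    left produces the factor 2.\<close>
  moreover have "L2_norm a b g \<le> (2 * s) * L2_norm a b (\<lambda>t. T0 g t + D g t)" if g: "L2 a b g" for g
  proof -
    let ?T = "\<lambda>t. T0 g t + D g t"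
    have "L2_norm a b (T0 g) = L2_norm a b (\<lambda>t. ?T t - D g t)" by simp
    also have "\<dots> \<le> L2_norm a b ?T + L2_norm a b (D g)"
      by (intro L2_norm_triangle_diff L2_add L2T0 L2D g)
    also have "\<dots> \<le> L2_norm a b ?T + \<eta> * sqrt (b - a) * L2_norm a b g" using D_norm[OF g] by simp
    finally have T0: "L2_norm a b (T0 g) \<le> L2_norm a b ?T + \<eta> * sqrt (b - a) * L2_norm a b g" .
    have "L2_norm a b g = L2_norm a b (S0 (T0 g))" by (intro L2_norm_cong) (simp add: ST)
    also have "\<dots> \<le> s * L2_norm a b (T0 g)" by (intro S0_le L2T0 g)
    also have "\<dots> \<le> s * (L2_norm a b ?T + \<eta> * sqrt (b - a) * L2_norm a b g)"
      by (intro mult_left_mono T0 s)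
    also have "\<dots> = s * L2_norm a b ?T + (\<eta> * s * sqrt (b - a)) * L2_norm a b g"
      by (simp add: algebra_simps)
    also have "\<dots> \<le> s * L2_norm a b ?T + 1 / 2 * L2_norm a b g"
      by (intro add_left_mono mult_right_mono small) simp
    finally show ?thesis by simp
  qed
  moreover have "\<exists>g. L2 a b g \<and> L2_norm a b (\<lambda>t. (T0 g t + D g t) - h t) = 0" if h: "L2 a b h" for h
  proof -
    have L: "L2_linear a b (\<lambda>g. D (S0 g))" by (rule L2_linear_compose[OF D S0])
    have "cmod (D (S0 g) t) \<le> (\<eta> * s) * L2_norm a b g" if g: "L2 a b g" and t: "t \<in> {a..b}" for g t
      using D_le[OF L2S0[OF g] t] mult_left_mono[OF S0_le[OF g] \<eta>] by (simp add: mult.assoc)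
    from Neumann_series[OF ab L this _ small h] obtain u
      where u: "L2 a b u" "\<And>t. t \<in> {a..b} \<Longrightarrow> u t + D (S0 u) t = D (S0 h) t"
      using \<eta> s by auto
    \<comment> \<open>By the choice of u, h - u solves x + D (S0 x) = h, so its image under
      \<open>S0\<close> solves the perturbed equation.\<close>
    define g where "g = S0 (\<lambda>t. h t - u t)"
    have g: "L2 a b g" unfolding g_def by (intro L2S0 L2_diff h u)
    have "T0 g t + D g t = h t" if t: "t \<in> {a..b}" for t
    proof -
      have "D g t = D (S0 h) t - D (S0 u) t"
        unfolding g_def by (rule fun_cong[OF L2_linear_diff[OF L h u(1)]])
      moreover have "T0 g t = h t - u t" unfolding g_def using TS[OF t] by simp
      ultimately show ?thesis unfolding u(2)[OF t, symmetric] by simp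
    qed
    then have "L2_norm a b (\<lambda>t. (T0 g t + D g t) - h t) = L2_norm a b (\<lambda>t. 0)"
      by (intro L2_norm_cong) simp
    then show ?thesis using g by auto
  qed
  ultimately show ?thesis unfolding L2_iso_def by blast
qed

section \<open>Operators prescribed by their values on an orthonormal basis\<close>

lemma Cauchy_Schwarz_series:
  fixes c d :: "nat \<Rightarrow> complex"
  assumes c: "summable (\<lambda>n. (cmod (c n))^2)" and d: "summable (\<lambda>n. (cmod (d n))^2)"
  shows "summable (\<lambda>n. c n * d n)"
    and "cmod (\<Sum>n. c n * d n) \<le> sqrt (\<Sum>n. (cmod (c n))^2) * sqrt (\<Sum>n. (cmod (d n))^2)"
proof -
  let ?B = "sqrt (\<Sum>n. (cmod (c n))^2) * sqrt (\<Sum>n. (cmod (d n))^2)"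
  have fin: "(\<Sum>n<N. cmod (c n * d n)) \<le> ?B" for N
  proof -
    have "(\<Sum>n<N. cmod (c n) * cmod (d n))^2 \<le> (\<Sum>n<N. (cmod (c n))^2) * (\<Sum>n<N. (cmod (d n))^2)"
      by (rule Cauchy_Schwarz_ineq_sum)
    also have "\<dots> \<le> (\<Sum>n. (cmod (c n))^2) * (\<Sum>n. (cmod (d n))^2)"
      by (intro mult_mono sum_le_suminf c d) (auto intro!: sum_nonneg suminf_nonneg c d)
    finally show ?thesis by (simp add: norm_mult real_le_rsqrt flip: real_sqrt_mult)
  qed
  have s: "summable (\<lambda>n. cmod (c n * d n))" by (rule summableI_nonneg_bounded[OF _ fin]) simp
  then show "summable (\<lambda>n. c n * d n)" by (rule summable_norm_cancel)
  have "cmod (\<Sum>n. c n * d n) \<le> (\<Sum>n. cmod (c n * d n))" by (rule summable_norm[OF s])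
  also have "\<dots> \<le> ?B" by (rule suminf_le_const[OF s fin])
  finally show "cmod (\<Sum>n. c n * d n) \<le> ?B" .
qed

context L2_onb
begin

lemma summable_coef: "L2 a b g \<Longrightarrow> summable (\<lambda>n. (cmod (coef g n))^2)"
  by (rule summableI_nonneg_bounded[OF _ Bessel_finite]) auto

lemma Bessel: "L2 a b g \<Longrightarrow> (\<Sum>n. (cmod (coef g n))^2) \<le> (L2_norm a b g)^2"
  by (rule suminf_le_const[OF summable_coef Bessel_finite])

lemma coef_comb2:
  "L2 a b g \<Longrightarrow> L2 a b h \<Longrightarrow> coef (\<lambda>t. \<alpha> * g t + \<beta> * h t) n = \<alpha> * coef g n + \<beta> * coef h n"
  by (subst L2_inner_add_left) (auto intro: L2_scale L2_e simp: L2_inner_scale_left)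

text \<open>At each fixed t, Cauchy-Schwarz and Bessel's inequality bound the series by \<eta> times
  the norm of g, which is a sup bound and not only an L2 bound. Summability is assumed at every real
  t, since linearity is an equality of functions on the whole line.\<close>

lemma coef_series_operator:
  assumes d: "\<And>n. L2 a b (d n)" and summ: "\<And>t. summable (\<lambda>n. (cmod (d n t))^2)"
    and le: "\<And>t. t \<in> {a..b} \<Longrightarrow> (\<Sum>n. (cmod (d n t))^2) \<le> \<eta>^2" and \<eta>: "0 \<le> \<eta>"
  defines "D \<equiv> \<lambda>g t. \<Sum>n. coef g n * d n t"
  shows "L2_linear a b D"
    and "\<And>g t. L2 a b g \<Longrightarrow> t \<in> {a..b} \<Longrightarrow> cmod (D g t) \<le> \<eta> * L2_norm a b g"
    and "\<And>n. D (e n) = d n"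
proof -
  have conv: "summable (\<lambda>n. coef g n * d n t)" if "L2 a b g" for g t
    using that by (intro Cauchy_Schwarz_series summable_coef summ)
  show bound: "cmod (D g t) \<le> \<eta> * L2_norm a b g" if g: "L2 a b g" and t: "t \<in> {a..b}" for g t
  proof -
    have "cmod (D g t) \<le> sqrt (\<Sum>n. (cmod (coef g n))^2) * sqrt (\<Sum>n. (cmod (d n t))^2)"
      unfolding D_def by (intro Cauchy_Schwarz_series summable_coef summ g)
    also have "\<dots> \<le> sqrt ((L2_norm a b g)^2) * sqrt (\<eta>^2)"
      by (intro mult_mono real_sqrt_le_mono Bessel le g t) (auto intro!: suminf_nonneg summ)
    finally show ?thesis using \<eta> by (simp add: mult.commute)
  qed
  show "L2_linear a b D" unfolding L2_linear_def
  proof (intro conjI allI impI)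
    fix g assume g: "L2 a b g"
    show "L2 a b (D g)"
    proof (rule L2_bounded)
      have "L2 a b (\<lambda>t. \<Sum>k<n. coef g k * d k t)" for n by (intro L2_sum L2_scale d)
      then show "D g \<in> borel_measurable (restrict_space lborel {a..b})"
        unfolding D_def
        by (intro borel_measurable_LIMSEQ_metric[where f="\<lambda>n t. \<Sum>k<n. coef g k * d k t", OF L2_measurable]
            summable_LIMSEQ conv g)
    qed (rule bound[OF g])
  next
    fix g h and \<alpha> \<beta> :: complex
    assume gh: "L2 a b g" "L2 a b h"
    show "D (\<lambda>t. \<alpha> * g t + \<beta> * h t) = (\<lambda>t. \<alpha> * D g t + \<beta> * D h t)"
    proof
      fix t
      have "D (\<lambda>t. \<alpha> * g t + \<beta> * h t) t = (\<Sum>n. \<alpha> * (coef g n * d n t) + \<beta> * (coef h n * d n t))"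
        unfolding D_def by (simp add: coef_comb2[OF gh] algebra_simps)
      also have "\<dots> = (\<Sum>n. \<alpha> * (coef g n * d n t)) + (\<Sum>n. \<beta> * (coef h n * d n t))"
        by (intro suminf_add[symmetric] summable_mult conv gh)
      also have "\<dots> = \<alpha> * D g t + \<beta> * D h t"
        unfolding D_def by (intro arg_cong2[where f="(+)"] suminf_mult conv gh)
      finally show "D (\<lambda>t. \<alpha> * g t + \<beta> * h t) t = \<alpha> * D g t + \<beta> * D h t" .
    qed
  qed
  show "D (e n) = d n" for n
  proof
    fix t
    have "D (e n) t = (\<Sum>k\<in>{n}. coef (e n) k * d k t)"
      unfolding D_def by (rule suminf_finite) (auto simp: orthonormal)
    then show "D (e n) t = d n t" by (simp add: orthonormal)
  qed
qed

end

section \<open>Replacing one frequency\<close>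

lemma L2_norm_Icc_mono:
  assumes "L2 a c f" "b \<le> c"
  shows "L2_norm a b f \<le> L2_norm a c f"
proof -
  have sub: "set_integrable lborel {a..c} (\<lambda>t. (cmod (f t))^2)" using assms(1) unfolding L2_def by simp
  have "set_integrable lborel {a..b} (\<lambda>t. (cmod (f t))^2)"
    by (rule set_integrable_subset[OF sub]) (use assms(2) in auto)
  then show ?thesis
    using sub assms(2) unfolding L2_norm_def set_lebesgue_integral_def set_integrable_def
    by (intro real_sqrt_le_mono integral_mono) (auto simp: indicator_def)
qed

text \<open>The second factor is the Duhamel kernel of y'' + \<nu>^2 y = g with y(0) = y'(0) = 0. A
  particular solution for g = sin(\<omega>s) is a multiple of that sine; the multiple of sin(\<nu>t)
  corrects its initial slope.\<close>

lemma L2_inner_sin_kernel: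
  assumes t: "0 \<le> t" and \<nu>: "0 < \<nu>" and ne: "\<nu>^2 \<noteq> \<omega>^2"
  shows "L2_inner 0 t (\<lambda>s. complex_of_real (sin (\<omega> * s))) (\<lambda>s. complex_of_real (sin (\<nu> * (t - s)) / \<nu>)) =
    complex_of_real ((sin (\<omega> * t) - \<omega> / \<nu> * sin (\<nu> * t)) / (\<nu>^2 - \<omega>^2))"
proof -
  \<comment> \<open>The numerator is the Wronskian f' w - f w' of f = sin(\<omega>s) and w =
    sin(\<nu>(t - s)), whose derivative is (\<nu>^2 - \<omega>^2) f w.\<close>
  define F where "F = (\<lambda>s. (\<nu> * cos (\<nu> * (t - s)) * sin (\<omega> * s) + \<omega> * sin (\<nu> * (t - s)) * cos (\<omega> * s))
      / (\<nu> * (\<nu>^2 - \<omega>^2)))"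
  have "L2_inner 0 t (\<lambda>s. complex_of_real (sin (\<omega> * s))) (\<lambda>s. complex_of_real (sin (\<nu> * (t - s)) / \<nu>))
      = complex_of_real (F t) - complex_of_real (F 0)"
  proof (rule L2_inner_FTC[OF t])
    fix s
    have "((\<lambda>s. \<nu> * cos (\<nu> * (t - s)) * sin (\<omega> * s) + \<omega> * sin (\<nu> * (t - s)) * cos (\<omega> * s))
        has_real_derivative (\<nu>^2 - \<omega>^2) * (sin (\<nu> * (t - s)) * sin (\<omega> * s))) (at s)"
      by (auto intro!: derivative_eq_intros simp: algebra_simps power2_eq_square)
    then have "(F has_real_derivative (\<nu>^2 - \<omega>^2) * (sin (\<nu> * (t - s)) * sin (\<omega> * s)) / (\<nu> * (\<nu>^2 - \<omega>^2))) (at s)"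
      unfolding F_def by (rule DERIV_cdivide)
    also have "(\<nu>^2 - \<omega>^2) * (sin (\<nu> * (t - s)) * sin (\<omega> * s)) / (\<nu> * (\<nu>^2 - \<omega>^2))
        = sin (\<omega> * s) * (sin (\<nu> * (t - s)) / \<nu>)"
      using \<nu> ne by simp
    finally have "(F has_real_derivative sin (\<omega> * s) * (sin (\<nu> * (t - s)) / \<nu>)) (at s)" .
    then have "((\<lambda>s. complex_of_real (F s)) has_vector_derivative
        complex_of_real (sin (\<omega> * s) * (sin (\<nu> * (t - s)) / \<nu>))) (at s within {0..t})"
      by (rule has_vector_derivative_of_real[OF has_field_derivative_at_within])
    then show "((\<lambda>s. complex_of_real (F s)) has_vector_derivative
        complex_of_real (sin (\<omega> * s)) * cnj (complex_of_real (sin (\<nu> * (t - s)) / \<nu>))) (at s within {0..t})"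
      by simp
  qed (auto intro!: continuous_intros simp: \<nu> less_imp_neq[symmetric])
  also have "\<dots> = complex_of_real (F t - F 0)" by simp
  also have "F t - F 0 = (\<nu> * (sin (\<omega> * t) - \<omega> / \<nu> * sin (\<nu> * t))) / (\<nu> * (\<nu>^2 - \<omega>^2))"
    unfolding F_def using \<nu> by (simp add: right_diff_distrib flip: diff_divide_distrib)
  also have "\<dots> = (sin (\<omega> * t) - \<omega> / \<nu> * sin (\<nu> * t)) / (\<nu>^2 - \<omega>^2)"
    using \<nu> by simp
  finally show ?thesis .
qed

lemma L2_norm_sin_nonzero:
  assumes b: "0 < b" and \<rho>: "0 < \<rho>"
  shows "L2_norm 0 b (\<lambda>t. complex_of_real (sin (\<rho> * t))) \<noteq> 0"
proof
  assume "L2_norm 0 b (\<lambda>t. complex_of_real (sin (\<rho> * t))) = 0"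
  then have "set_lebesgue_integral lborel {0..b} (\<lambda>t. (sin (\<rho> * t))^2) = 0"
    unfolding L2_norm_def by simp
  moreover have "set_integrable lborel {0..b} (\<lambda>t. (sin (\<rho> * t))^2)"
    by (intro borel_integrable_atLeastAtMost' continuous_intros)
  ultimately have int: "((\<lambda>t. (sin (\<rho> * t))^2) has_integral 0) (cbox 0 b)"
    using set_borel_integral_eq_integral[of "{0..b}" "\<lambda>t. (sin (\<rho> * t))^2"]
    by (simp add: has_integral_iff)
  \<comment> \<open>A continuous nonnegative function with zero integral vanishes everywhere, yet at
    this x the argument of the sine lies in (0, 1], below \<pi>.\<close>
  define x where "x = min b (1 / \<rho>)"
  have x: "x \<in> {0..b}" "0 < x" "\<rho> * x \<le> 1" using b \<rho> by (auto simp: x_def min_def field_simps)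
  have "(sin (\<rho> * x))^2 = 0"
    by (rule has_integral_0_cbox_imp_0[OF _ _ int]) (use x b in \<open>auto intro!: continuous_intros\<close>)
  moreover have "0 < sin (\<rho> * x)"
    using x \<rho> pi_gt3 by (intro sin_gt_zero) auto
  ultimately show False by simp
qed

context L2_onb
begin

definition riesz_seq :: "(nat \<Rightarrow> real \<Rightarrow> complex) \<Rightarrow> bool" where
  "riesz_seq f \<longleftrightarrow> (\<exists>T. L2_iso a b T \<and> (\<forall>n. \<forall>t\<in>{a..b}. T (e n) t = f n t))"

lemma coef_bound: "L2 a b g \<Longrightarrow> cmod (coef g n) \<le> L2_norm a b g"
  using L2_inner_bound[OF _ L2_e, of g n] by (simp add: norm_e)

lemma norm_le_add_diff:
  assumes "L2 a b f" "L2 a b g"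
  shows "L2_norm a b f \<le> L2_norm a b g + L2_norm a b (\<lambda>t. f t - g t)"
  using L2_norm_triangle[OF assms(2) L2_diff[OF assms]] by simp

text \<open>The rank one perturbation 1 + <., e j> (v - e j) has determinant 1 + <v - e j, e j> =
  \<open>coef v j\<close>, hence is invertible when this is nonzero.\<close>

lemma riesz_seq_replace:
  assumes T: "L2_iso a b T" and Te: "\<And>n t. t \<in> {a..b} \<Longrightarrow> T (e n) t = f n t"
    and v: "L2 a b v" and f': "L2 a b f'" and Tv: "L2_norm a b (\<lambda>t. T v t - f' t) = 0"
    and \<beta>: "coef v j \<noteq> 0"
  shows "riesz_seq (f(j := f'))"
proof -
  let ?\<beta> = "coef v j"
  have lin: "L2_linear a b T" using T unfolding L2_iso_def by blast
  obtain C where C: "\<And>g. L2 a b g \<Longrightarrow> L2_norm a b (T g) \<le> C * L2_norm a b g"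
    using T unfolding L2_iso_def by blast
  obtain D where D: "\<And>g. L2 a b g \<Longrightarrow> L2_norm a b g \<le> D * L2_norm a b (T g)"
    using T unfolding L2_iso_def by blast
  have surj: "\<And>h. L2 a b h \<Longrightarrow> \<exists>g. L2 a b g \<and> L2_norm a b (\<lambda>t. T g t - h t) = 0"
    using T unfolding L2_iso_def by blast
  note L2T = L2_linear_L2[OF lin]
  \<comment> \<open>The difference is taken with \<open>f'\<close> and not with \<open>T v\<close>,
    which agrees with it only up to null sets, so that the new operator maps \<open>e j\<close> to
    \<open>f'\<close> pointwise.\<close>
  define d where "d = (\<lambda>t. f' t - T (e j) t)"
  have d: "L2 a b d" unfolding d_def by (intro L2_diff f' L2T L2_e)
  define T' where "T' = (\<lambda>g t. T g t + coef g j * d t)"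
  have lin': "L2_linear a b T'"
    unfolding L2_linear_def
  proof (intro conjI allI impI)
    show "L2 a b (T' g)" if "L2 a b g" for g
      unfolding T'_def by (intro L2_add L2_scale L2T that d)
    show "T' (\<lambda>t. \<alpha> * g t + \<beta> * h t) = (\<lambda>t. \<alpha> * T' g t + \<beta> * T' h t)"
      if "L2 a b g" "L2 a b h" for g h \<alpha> \<beta>
      unfolding T'_def using L2_linear_comb[OF lin that] coef_comb2[OF that]
      by (simp add: algebra_simps)
  qed
  let ?w = "\<lambda>t. v t - e j t"
  have w: "L2 a b ?w" by (intro L2_diff v L2_e)
  have coef_w: "coef ?w j = ?\<beta> - 1"
    by (subst L2_inner_diff_left) (auto simp: v L2_e orthonormal)
  \<comment> \<open>up to null sets, \<open>T'\<close> is \<open>T\<close> composed with the rank one perturbation \<open>x \<mapsto> x + \<langle>x, e j\<rangle> w\<close> of the identity\<close>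
  have T'_norm: "L2_norm a b (\<lambda>t. T' x t - T (\<lambda>t. x t + coef x j * ?w t) t) = 0" if x: "L2 a b x" for x
  proof -
    have "T (\<lambda>t. x t + coef x j * ?w t) = (\<lambda>t. 1 * T x t + coef x j * T ?w t)"
      using L2_linear_comb[OF lin x w, of 1 "coef x j"] by simp
    also have "T ?w = (\<lambda>t. T v t - T (e j) t)" by (rule L2_linear_diff[OF lin v L2_e])
    finally have "(\<lambda>t. T' x t - T (\<lambda>t. x t + coef x j * ?w t) t) = (\<lambda>t. - coef x j * (T v t - f' t))"
      by (simp add: T'_def d_def algebra_simps)
    then show ?thesis by (simp only: L2_norm_scale Tv)
  qed
  have "L2_norm a b (T' x) \<le> (C + L2_norm a b d) * L2_norm a b x" if x: "L2 a b x" for x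
  proof -
    have "L2_norm a b (T' x) \<le> L2_norm a b (T x) + L2_norm a b (\<lambda>t. coef x j * d t)"
      unfolding T'_def by (intro L2_norm_triangle L2T x L2_scale d)
    also have "\<dots> \<le> C * L2_norm a b x + L2_norm a b x * L2_norm a b d"
      unfolding L2_norm_scale by (intro add_mono C x mult_right_mono coef_bound) simp
    finally show ?thesis by (simp add: algebra_simps)
  qed
  moreover have "L2_norm a b x \<le> ((1 + L2_norm a b ?w / cmod ?\<beta>) * \<bar>D\<bar>) * L2_norm a b (T' x)"
    if x: "L2 a b x" for x
  proof -
    define y where "y = (\<lambda>t. x t + coef x j * ?w t)"
    have y: "L2 a b y" unfolding y_def by (intro L2_add x L2_scale w)
    \<comment> \<open>The perturbation multiplies the j-th coefficient by \<open>?\<beta>\<close>;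
      dividing by it recovers x from y.\<close>
    have "coef y j = coef x j + coef x j * (?\<beta> - 1)"
      unfolding y_def using coef_comb2[OF x w, of 1 "coef x j" j] coef_w by simp
    then have yj: "coef x j = coef y j / ?\<beta>" using \<beta> by (simp add: algebra_simps)
    have "L2_norm a b x \<le> L2_norm a b y + L2_norm a b (\<lambda>t. x t - y t)"
      by (rule norm_le_add_diff[OF x y])
    also have "(\<lambda>t. x t - y t) = (\<lambda>t. - coef x j * ?w t)" by (simp add: y_def)
    also have "L2_norm a b \<dots> = cmod (coef y j) / cmod ?\<beta> * L2_norm a b ?w"
      unfolding L2_norm_scale by (simp add: yj norm_divide)
    also have "\<dots> \<le> L2_norm a b y / cmod ?\<beta> * L2_norm a b ?w"
      by (intro mult_right_mono divide_right_mono coef_bound y) auto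
    finally have "L2_norm a b x \<le> (1 + L2_norm a b ?w / cmod ?\<beta>) * L2_norm a b y"
      by (simp add: algebra_simps)
    also have "L2_norm a b y \<le> \<bar>D\<bar> * L2_norm a b (T y)"
      by (rule order_trans[OF D[OF y]]) (intro mult_right_mono; simp)
    also have "L2_norm a b (T y) \<le> L2_norm a b (T' x) + L2_norm a b (\<lambda>t. T y t - T' x t)"
      by (intro norm_le_add_diff L2T y L2_linear_L2[OF lin' x])
    also have "L2_norm a b (\<lambda>t. T y t - T' x t) = 0"
      unfolding L2_norm_minus_commute[of a b "T y"] using T'_norm[OF x] by (simp add: y_def)
    finally show ?thesis by (simp add: mult.assoc mult_left_mono add_nonneg_nonneg)
  qed
  moreover have "\<exists>x. L2 a b x \<and> L2_norm a b (\<lambda>t. T' x t - h t) = 0" if h: "L2 a b h" for h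
  proof -
    obtain y where y: "L2 a b y" "L2_norm a b (\<lambda>t. T y t - h t) = 0" using surj[OF h] by blast
    \<comment> \<open>The value that the j-th coefficient of a preimage of y under the rank one
      perturbation must have.\<close>
    define s where "s = coef y j / ?\<beta>"
    define x where "x = (\<lambda>t. y t - s * ?w t)"
    have x: "L2 a b x" unfolding x_def by (intro L2_diff y L2_scale w)
    have "coef x j = coef y j - s * (?\<beta> - 1)"
      unfolding x_def using coef_comb2[OF y(1) w, of 1 "-s" j] coef_w by simp
    then have "coef x j = s" using \<beta> by (simp add: s_def field_simps)
    then have "(\<lambda>t. x t + coef x j * ?w t) = y" by (simp add: x_def)
    then have "L2_norm a b (\<lambda>t. T' x t - T y t) = 0" using T'_norm[OF x] by simp
    moreover have "L2_norm a b (\<lambda>t. (T' x t - T y t) + (T y t - h t)) \<le>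
        L2_norm a b (\<lambda>t. T' x t - T y t) + L2_norm a b (\<lambda>t. T y t - h t)"
      by (intro L2_norm_triangle L2_diff L2T L2_linear_L2[OF lin' x] y h)
    ultimately show ?thesis using x y(2) L2_norm_nonneg[of a b "\<lambda>t. T' x t - h t"]
      by (intro exI[of _ x]) simp
  qed
  ultimately have "L2_iso a b T'" using lin' unfolding L2_iso_def by blast
  moreover have "T' (e n) t = (f(j := f')) n t" if "t \<in> {a..b}" for n t
    using Te[OF that] by (simp add: T'_def d_def orthonormal)
  ultimately show ?thesis unfolding riesz_seq_def by blast
qed

text \<open>If \<open>coef v j = 0\<close>, then \<open>f'\<close> is a series in the
  \<open>f i\<close> with i different from j. In c0 f' - V f' the function \<open>f'\<close>
  cancels, leaving a relation with coefficients \<open>coef v i * (c0 - c i)\<close> and some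
  multiple of \<open>f j\<close>. Uniqueness of expansions and \<open>c i\<close> different from
  \<open>c0\<close> force v = 0 in norm, hence \<open>f'\<close> = 0 in norm, which is absurd. All
  this is carried out on partial sums.\<close>

lemma riesz_seq_sin_replace:
  assumes a0: "a = 0" and b: "0 < b"
    and riesz: "riesz_seq (\<lambda>n t. complex_of_real (sin (\<omega> n * t)))"
    and pos: "\<And>n. 0 < \<omega> n" and dist: "\<And>n. n \<noteq> j \<Longrightarrow> \<omega> n \<noteq> \<omega> j"
    and \<rho>: "0 < \<rho>" and new: "\<And>n. \<rho> \<noteq> \<omega> n"
  shows "riesz_seq (\<lambda>n t. complex_of_real (sin (fun_upd \<omega> j \<rho> n * t)))"
proof -
  define f where "f = (\<lambda>n t. complex_of_real (sin (\<omega> n * t)))"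
  define f' where "f' = (\<lambda>t. complex_of_real (sin (\<rho> * t)))"
  define \<nu> where "\<nu> = \<omega> j"
  have \<nu>: "0 < \<nu>" using pos by (simp add: \<nu>_def)
  have contf: "continuous_on S (f n)" for S n unfolding f_def by (intro continuous_intros)
  have contf': "continuous_on S f'" for S unfolding f'_def by (intro continuous_intros)
  have L2f: "L2 x y (f n)" for x y n by (intro L2_continuous contf)
  have L2f': "L2 x y f'" for x y by (intro L2_continuous contf')
  obtain T where T: "L2_iso a b T" and Te: "\<And>n t. t \<in> {a..b} \<Longrightarrow> T (e n) t = f n t"
    using riesz unfolding riesz_seq_def f_def by blast
  have lin: "L2_linear a b T" using T unfolding L2_iso_def by blast
  obtain C where C: "\<And>g. L2 a b g \<Longrightarrow> L2_norm a b (T g) \<le> C * L2_norm a b g"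
    using T unfolding L2_iso_def by blast
  obtain D where D: "\<And>g. L2 a b g \<Longrightarrow> L2_norm a b g \<le> D * L2_norm a b (T g)"
    using T unfolding L2_iso_def by blast
  obtain v where v: "L2 a b v" and Tv: "L2_norm a b (\<lambda>t. T v t - f' t) = 0"
    using T L2f' unfolding L2_iso_def by blast
  note L2T = L2_linear_L2[OF lin]
  show ?thesis
  proof (cases "coef v j = 0")
    case False
    have "riesz_seq (f(j := f'))" by (rule riesz_seq_replace[OF T Te v L2f' Tv False])
    moreover have "f(j := f') = (\<lambda>n t. complex_of_real (sin (fun_upd \<omega> j \<rho> n * t)))"
      by (auto simp: f_def f'_def fun_eq_iff)
    ultimately show ?thesis by simp
  next
    case vj: True
    define c0 where "c0 = complex_of_real (1 / (\<nu>^2 - \<rho>^2))"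
    define c where "c = (\<lambda>i. complex_of_real (1 / (\<nu>^2 - (\<omega> i)^2)))"
    have sq_ne: "x^2 \<noteq> y^2" if "0 < x" "0 < y" "x \<noteq> y" for x y :: real
      using that by (simp add: power2_eq_iff)
    define \<kappa> where "\<kappa> = (\<lambda>t s. complex_of_real (sin (\<nu> * (t - s)) / \<nu>))"
    have L2\<kappa>: "L2 x y (\<kappa> t)" for x y t
      unfolding \<kappa>_def by (intro L2_continuous continuous_intros) (use \<nu> in auto)
    \<comment> \<open>\<open>V\<close> solves \<open>y'' + \<nu>\<^sup>2 y = g\<close> with zero initial data; it almost diagonalises the sines\<close>
    define V where "V = (\<lambda>g t. L2_inner 0 t g (\<kappa> t))"
    have V_f': "V f' t = c0 * (f' t - complex_of_real (\<rho> / \<nu>) * f j t)" if "0 \<le> t" for t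
      unfolding V_def \<kappa>_def f'_def f_def c0_def
      using L2_inner_sin_kernel[OF that \<nu>, of \<rho>] sq_ne[OF \<nu> \<rho>] new[of j]
      by (simp add: \<nu>_def)
    have V_f: "V (f i) t = c i * (f i t - complex_of_real (\<omega> i / \<nu>) * f j t)" if "0 \<le> t" "i \<noteq> j" for i t
      unfolding V_def \<kappa>_def f_def c_def
      using L2_inner_sin_kernel[OF that(1) \<nu>, of "\<omega> i"] sq_ne[OF \<nu> pos[of i]] dist[OF that(2)]
      by (simp add: \<nu>_def)
    have V_bound: "cmod (V g t) \<le> L2_norm 0 b g * (1 / \<nu> * sqrt b)"
      if g: "L2 0 b g" "L2 0 t g" and t: "t \<in> {0..b}" for g t
    proof -
      have "cmod (V g t) \<le> L2_norm 0 t g * L2_norm 0 t (\<kappa> t)"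
        unfolding V_def by (intro L2_inner_bound g L2\<kappa>)
      also have "\<dots> \<le> L2_norm 0 b g * (1 / \<nu> * sqrt b)"
      proof (intro mult_mono)
        have "L2_norm 0 t (\<kappa> t) \<le> 1 / \<nu> * sqrt (t - 0)"
          by (intro L2_norm_bounded) (use t \<nu> in \<open>auto simp: \<kappa>_def norm_divide intro!: divide_right_mono\<close>)
        also have "\<dots> \<le> 1 / \<nu> * sqrt b" by (intro mult_left_mono) (use t \<nu> in auto)
        finally show "L2_norm 0 t (\<kappa> t) \<le> 1 / \<nu> * sqrt b" .
        show "L2_norm 0 t g \<le> L2_norm 0 b g" by (rule L2_norm_Icc_mono[OF g(1)]) (use t in simp)
      qed simp_all
      finally show ?thesis .
    qed
    define u where "u = (\<lambda>n t. (\<Sum>i<n. coef v i * f i t) - f' t)"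
    have L2u: "L2 x y (u n)" for x y n unfolding u_def by (intro L2_diff L2_sum L2_scale L2f L2f')
    have u_lim: "(\<lambda>n. L2_norm a b (u n)) \<longlonglongrightarrow> 0"
    proof (rule tendsto_sandwich[OF _ _ tendsto_const])
      show "\<forall>\<^sub>F n in sequentially. L2_norm a b (u n)
          \<le> C * L2_norm a b (\<lambda>t. v t - (\<Sum>i<n. coef v i * e i t))"
      proof (intro always_eventually allI)
        fix n
        let ?s = "\<lambda>t. \<Sum>i<n. coef v i * e i t"
        have "L2_norm a b (u n) = L2_norm a b (\<lambda>t. (T v t - f' t) - T (\<lambda>t. v t - ?s t) t)"
          unfolding L2_linear_diff[OF lin v L2_comb] L2_linear_sum[OF lin L2_e]
          by (intro L2_norm_cong) (simp add: u_def Te)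
        also have "\<dots> \<le> L2_norm a b (\<lambda>t. T v t - f' t) + L2_norm a b (T (\<lambda>t. v t - ?s t))"
          by (intro L2_norm_triangle_diff L2_diff L2T v L2f' L2_comb)
        also have "\<dots> \<le> C * L2_norm a b (\<lambda>t. v t - ?s t)"
          unfolding Tv by (simp add: C L2_diff v L2_comb)
        finally show "L2_norm a b (u n) \<le> C * L2_norm a b (\<lambda>t. v t - ?s t)" .
      qed
      show "(\<lambda>n. C * L2_norm a b (\<lambda>t. v t - (\<Sum>i<n. coef v i * e i t))) \<longlonglongrightarrow> 0"
        using tendsto_mult[OF tendsto_const expansion_tendsto[OF v], of C] by simp
    qed simp
    define \<gamma> where "\<gamma> = (\<lambda>n. (\<Sum>i<n. coef v i * c i * complex_of_real (\<omega> i / \<nu>)) - c0 * complex_of_real (\<rho> / \<nu>))"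
    define s where "s = (\<lambda>n t. \<Sum>i<n. (coef v i * (c0 - c i)) * e i t)"
    define z where "z = (\<lambda>n t. 1 * s n t + \<gamma> n * e j t)"
    have L2s: "L2 a b (s n)" for n unfolding s_def by (rule L2_comb)
    have L2z: "L2 a b (z n)" for n unfolding z_def by (intro L2_add L2_scale L2s L2_e)
    have Tz: "T (z n) t = c0 * u n t - V (u n) t" if t: "t \<in> {a..b}" for n t
    proof -
      have t0: "0 \<le> t" using t a0 by simp
      have "V (u n) t = (\<Sum>i<n. coef v i * V (f i) t) - V f' t"
        unfolding V_def u_def
        by (subst L2_inner_diff_left)
          (simp_all add: L2_inner_sum_left L2_inner_scale_left L2f L2f' L2\<kappa> L2_sum L2_scale)
      also have "(\<Sum>i<n. coef v i * V (f i) t) =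
          (\<Sum>i<n. coef v i * (c i * (f i t - complex_of_real (\<omega> i / \<nu>) * f j t)))"
      proof (intro sum.cong refl)
        fix i
        show "coef v i * V (f i) t = coef v i * (c i * (f i t - complex_of_real (\<omega> i / \<nu>) * f j t))"
        \<comment> \<open>The formula for \<open>V (f i)\<close> excludes the resonant index j,
          whose term has coefficient 0.\<close>
        proof (cases "i = j")
          case False
          show ?thesis unfolding V_f[OF t0 False] ..
        qed (simp add: vj)
      qed
      finally have V: "V (u n) t =
          (\<Sum>i<n. coef v i * (c i * (f i t - complex_of_real (\<omega> i / \<nu>) * f j t)))
          - c0 * (f' t - complex_of_real (\<rho> / \<nu>) * f j t)"
        unfolding V_f'[OF t0] .
      have "T (z n) = (\<lambda>t. 1 * T (s n) t + \<gamma> n * T (e j) t)"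
        unfolding z_def by (rule L2_linear_comb[OF lin L2s L2_e])
      moreover have "T (s n) = (\<lambda>t. \<Sum>i<n. (coef v i * (c0 - c i)) * T (e i) t)"
        unfolding s_def by (rule L2_linear_sum[OF lin L2_e])
      ultimately have "T (z n) t = (\<Sum>i<n. (coef v i * (c0 - c i)) * f i t) + \<gamma> n * f j t"
        using Te[OF t] by simp
      then show ?thesis unfolding V unfolding u_def \<gamma>_def
        by (simp add: algebra_simps sum_subtractf sum_distrib_left sum_distrib_right)
    qed
    \<comment> \<open>The factor from \<open>D\<close> is the lower bound of \<open>T\<close>, in
      absolute value because its sign is unknown; 1/\<nu> * sqrt b bounds \<open>V\<close> from L2
      to the sup norm, and sqrt(b - a) leads back to L2.\<close>
    define K where "K = \<bar>D\<bar> * (cmod c0 + 1 / \<nu> * sqrt b * sqrt (b - a))"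
    have z_le: "L2_norm a b (z n) \<le> K * L2_norm a b (u n)" for n
    proof -
      have "cmod (T (z n) t - c0 * u n t) \<le> L2_norm a b (u n) * (1 / \<nu> * sqrt b)" if "t \<in> {a..b}" for t
        using V_bound[OF L2u L2u, of t n] Tz[OF that] that a0 by simp
      from L2_norm_bounded[OF a_le_b this]
      have 1: "L2_norm a b (\<lambda>t. T (z n) t - c0 * u n t)
          \<le> L2_norm a b (u n) * (1 / \<nu> * sqrt b) * sqrt (b - a)" .
      have "L2_norm a b (T (z n)) \<le> L2_norm a b (\<lambda>t. c0 * u n t) + L2_norm a b (\<lambda>t. T (z n) t - c0 * u n t)"
        by (intro norm_le_add_diff L2T L2z L2_scale L2u)
      also have "\<dots> \<le> (cmod c0 + 1 / \<nu> * sqrt b * sqrt (b - a)) * L2_norm a b (u n)"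
        using 1 by (simp add: L2_norm_scale algebra_simps)
      finally have 2: "L2_norm a b (T (z n)) \<le> (cmod c0 + 1 / \<nu> * sqrt b * sqrt (b - a)) * L2_norm a b (u n)" .
      have "L2_norm a b (z n) \<le> \<bar>D\<bar> * L2_norm a b (T (z n))"
        by (rule order_trans[OF D[OF L2z]]) (intro mult_right_mono; simp)
      also have "\<dots> \<le> \<bar>D\<bar> * ((cmod c0 + 1 / \<nu> * sqrt b * sqrt (b - a)) * L2_norm a b (u n))"
        by (intro mult_left_mono 2) simp
      finally show ?thesis by (simp add: K_def mult.assoc)
    qed
    have coef_v: "coef v i = 0" for i
    proof (cases "i = j")
      case False
      \<comment> \<open>The i-th coefficient of \<open>z n\<close> no longer changes once n exceeds
        i, while the norm of \<open>z n\<close> tends to 0.\<close>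
      have "cmod (coef v i * (c0 - c i)) \<le> K * L2_norm a b (u n)" if "n \<ge> Suc i" for n
      proof -
        have "coef (z n) i = 1 * coef (s n) i + \<gamma> n * coef (e j) i"
          unfolding z_def by (rule coef_comb2[OF L2s L2_e])
        also have "\<dots> = coef v i * (c0 - c i)"
          unfolding s_def coef_comb using that False by (simp add: orthonormal)
        finally have "coef (z n) i = coef v i * (c0 - c i)" .
        then show ?thesis using order_trans[OF coef_bound[OF L2z] z_le, of n i] by simp
      qed
      then have "\<exists>N. \<forall>n\<ge>N. cmod (coef v i * (c0 - c i)) \<le> K * L2_norm a b (u n)" by blast
      moreover have "(\<lambda>n. K * L2_norm a b (u n)) \<longlonglongrightarrow> 0"
        using tendsto_mult[OF tendsto_const u_lim, of K] by simp
      ultimately have "cmod (coef v i * (c0 - c i)) \<le> 0" by (intro LIMSEQ_le_const)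
      moreover have "c0 \<noteq> c i"
        using sq_ne[OF \<nu> \<rho>] sq_ne[OF \<nu> pos[of i]] sq_ne[OF \<rho> pos[of i]] new[of i] new[of j] dist[OF False]
        unfolding c0_def c_def \<nu>_def[symmetric] of_real_eq_iff by (auto simp: divide_eq_eq_1 frac_eq_eq \<nu>_def)
      ultimately show ?thesis by simp
    qed (use vj in simp)
    have "L2_norm a b f' \<le> L2_norm a b (T v) + L2_norm a b (\<lambda>t. f' t - T v t)"
      by (intro norm_le_add_diff L2f' L2T v)
    also have "\<dots> \<le> 0"
      using C[OF v] coef_zero_imp_norm_zero[OF v coef_v] Tv L2_norm_minus_commute[of a b "T v" f'] by simp
    finally have "L2_norm a b f' = 0" using L2_norm_nonneg[of a b f'] by linarith
    then show ?thesis using L2_norm_sin_nonzero[OF b \<rho>] a0 by (simp add: f'_def)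
  qed
qed

end

section \<open>Finitely many frequencies and the unperturbed system\<close>

context L2_onb
begin

text \<open>Equal members would make \<open>T\<close> annihilate \<open>e i - e j\<close>. This
  supplies the distinctness of the old frequencies that the replacement step requires.\<close>

lemma riesz_seq_inj:
  assumes "riesz_seq f" "\<And>t. t \<in> {a..b} \<Longrightarrow> f i t = f j t"
  shows "i = j"
proof (rule ccontr)
  assume ne: "i \<noteq> j"
  obtain T where T: "L2_iso a b T" and Te: "\<And>n t. t \<in> {a..b} \<Longrightarrow> T (e n) t = f n t"
    using assms(1) unfolding riesz_seq_def by blast
  have lin: "L2_linear a b T" using T unfolding L2_iso_def by blast
  obtain D where D: "\<And>g. L2 a b g \<Longrightarrow> L2_norm a b g \<le> D * L2_norm a b (T g)"
    using T unfolding L2_iso_def by blast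
  have d: "L2 a b (\<lambda>t. e i t - e j t)" by (intro L2_diff L2_e)
  have "L2_norm a b (T (\<lambda>t. e i t - e j t)) = L2_norm a b (\<lambda>t. 0)"
    unfolding L2_linear_diff[OF lin L2_e L2_e] by (intro L2_norm_cong) (simp add: Te assms(2))
  then have "L2_norm a b (\<lambda>t. e i t - e j t) \<le> 0" using D[OF d] by simp
  then have "coef (\<lambda>t. e i t - e j t) i = 0" using coef_bound[OF d, of i] by (meson norm_le_zero_iff order_trans)
  then show False using ne by (subst (asm) L2_inner_diff_left) (simp_all add: L2_e orthonormal)
qed

lemma riesz_seq_sin_finite_change:
  assumes a0: "a = 0" and b: "0 < b"
    and riesz: "riesz_seq (\<lambda>n t. complex_of_real (sin (\<omega> n * t)))"
    and \<omega>: "\<And>n. 0 < \<omega> n" and \<rho>: "\<And>n. 0 < \<rho> n" "inj \<rho>"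
    and eq: "\<And>n. n \<ge> N \<Longrightarrow> \<omega> n = \<rho> n"
  shows "riesz_seq (\<lambda>n t. complex_of_real (sin (\<rho> n * t)))"
proof -
  have inj_\<omega>: "\<omega> i \<noteq> \<omega> j" if "i \<noteq> j" for i j
    using riesz_seq_inj[OF riesz, of i j] that by auto
  \<comment> \<open>some \<open>\<rho> j\<close> may coincide with some \<open>\<omega> i\<close>, so the replacement passes through generic frequencies\<close>
  have "uncountable ({0<..<1} - (range \<omega> \<union> range \<rho>))"
    by (intro uncountable_minus_countable) (auto simp: uncountable_open_interval)
  then have "infinite ({0<..<1} - (range \<omega> \<union> range \<rho>))" by (rule uncountable_infinite)
  then obtain \<nu> :: "nat \<Rightarrow> real" where \<nu>: "inj \<nu>" "range \<nu> \<subseteq> {0<..<1} - (range \<omega> \<union> range \<rho>)"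
    using infinite_countable_subset by blast
  have \<nu>_pos: "0 < \<nu> n" for n using subsetD[OF \<nu>(2) rangeI[of \<nu> n]] by simp
  have \<nu>_\<omega>: "\<nu> n \<noteq> \<omega> k" "\<nu> n \<noteq> \<rho> k" for n k
    using \<nu>(2) by (metis DiffD2 UnCI rangeI subsetD)+
  have \<nu>_inj: "\<nu> i \<noteq> \<nu> j" if "i \<noteq> j" for i j using \<nu>(1) that by (auto dest: injD)
  have \<rho>_inj: "\<rho> i \<noteq> \<rho> j" if "i \<noteq> j" for i j using \<rho>(2) that by (auto dest: injD)
  \<comment> \<open>Two runs of N replacements: \<open>A\<close> moves the first N frequencies from
    \<omega> to the generic \<nu>, then \<open>B\<close> moves them from \<nu> to \<rho>. Beyond N
    both target systems already agree with \<rho>, so \<open>A N = B 0\<close>.\<close>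
  define A where "A = (\<lambda>k n. if n < k then \<nu> n else \<omega> n)"
  define B where "B = (\<lambda>k n. if n < k then \<rho> n else if n < N then \<nu> n else \<rho> n)"
  have "riesz_seq (\<lambda>n t. complex_of_real (sin (A k n * t)))" for k
  proof (induction k)
    case 0
    then show ?case using riesz by (simp add: A_def)
  next
    case (Suc k)
    have "riesz_seq (\<lambda>n t. complex_of_real (sin (fun_upd (A k) k (\<nu> k) n * t)))"
    proof (rule riesz_seq_sin_replace[OF a0 b Suc.IH])
      show "0 < A k n" for n using \<nu>_pos \<omega> by (simp add: A_def)
      show "n \<noteq> k \<Longrightarrow> A k n \<noteq> A k k" for n using \<nu>_\<omega> inj_\<omega> by (simp add: A_def)
      show "\<nu> k \<noteq> A k n" for n using \<nu>_\<omega> \<nu>_inj[of k n] by (simp add: A_def)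
    qed (rule \<nu>_pos)
    moreover have "fun_upd (A k) k (\<nu> k) = A (Suc k)" by (auto simp: A_def fun_eq_iff)
    ultimately show ?case by simp
  qed
  note A = this[of N]
  have "k \<le> N \<Longrightarrow> riesz_seq (\<lambda>n t. complex_of_real (sin (B k n * t)))" for k
  proof (induction k)
    case 0
    have "A N = B 0" by (auto simp: A_def B_def eq fun_eq_iff)
    then show ?case using A by simp
  next
    case (Suc k)
    then have IH: "riesz_seq (\<lambda>n t. complex_of_real (sin (B k n * t)))" and k: "k < N" by auto
    have "riesz_seq (\<lambda>n t. complex_of_real (sin (fun_upd (B k) k (\<rho> k) n * t)))"
    proof (rule riesz_seq_sin_replace[OF a0 b IH])
      show "0 < B k n" for n using \<nu>_pos \<rho> by (simp add: B_def)
      show "n \<noteq> k \<Longrightarrow> B k n \<noteq> B k k" for n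
        using \<nu>_\<omega>(2)[of k n] \<nu>_inj[of n k] k by (simp add: B_def)
      show "\<rho> k \<noteq> B k n" for n
        using \<nu>_\<omega>(2)[of n k] \<rho>_inj[of k n] k by (auto simp: B_def)
    qed (rule \<rho>)
    moreover have "fun_upd (B k) k (\<rho> k) = B (Suc k)" by (auto simp: B_def fun_eq_iff)
    ultimately show ?case by simp
  qed
  moreover have "B N = \<rho>" by (auto simp: B_def fun_eq_iff)
  ultimately show ?thesis using le_refl by metis
qed

end

section \<open>The unperturbed operator, built from multiplications and the reflection of the
  interval\<close>

lemma L2_reflect:
  assumes g: "L2 0 b g"
  shows "L2 0 b (\<lambda>t. g (b - t))" and "L2_norm 0 b (\<lambda>t. g (b - t)) = L2_norm 0 b g"
proof -
  have ind: "indicator {0..b} (b - t) = (indicator {0..b} t :: real)" for t :: real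
    by (auto simp: indicator_def)
  have m: "(\<lambda>x. indicator {0..b} x *\<^sub>R g x) \<in> borel_measurable lborel"
    and i: "integrable lborel (\<lambda>x. indicator {0..b} x *\<^sub>R (cmod (g x))^2)"
    using g unfolding L2_def set_borel_measurable_def set_integrable_def by auto
  have "(\<lambda>x. b - x) \<in> lborel \<rightarrow>\<^sub>M lborel" by measurable
  from measurable_compose[OF this m]
  have m': "(\<lambda>x. indicator {0..b} x *\<^sub>R g (b - x)) \<in> borel_measurable lborel" by (simp add: ind)
  have i': "integrable lborel (\<lambda>x. indicator {0..b} x *\<^sub>R (cmod (g (b - x)))^2)"
    using lborel_integrable_real_affine[OF i, of "-1" b] by (simp add: ind)
  show "L2 0 b (\<lambda>t. g (b - t))"
    using m' i' unfolding L2_def set_borel_measurable_def set_integrable_def by simp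
  show "L2_norm 0 b (\<lambda>t. g (b - t)) = L2_norm 0 b g"
    using lborel_integral_real_affine[of "-1" "\<lambda>x. indicator {0..b} x *\<^sub>R (cmod (g x))^2" b]
    unfolding L2_norm_def set_lebesgue_integral_def by (simp add: ind)
qed

lemma L2_mult_bounded:
  assumes g: "L2 a b g" and c: "continuous_on UNIV c" and le: "\<And>t. cmod (c t) \<le> B"
  shows "L2 a b (\<lambda>t. c t * g t)" and "L2_norm a b (\<lambda>t. c t * g t) \<le> B * L2_norm a b g"
proof -
  have B: "0 \<le> B" using order_trans[OF norm_ge_zero le] .
  have le': "cmod (c t * g t) \<le> cmod (complex_of_real B * g t)" for t
    using mult_right_mono[OF le[of t] norm_ge_zero[of "g t"]] B by (simp add: norm_mult)
  have Bg: "L2 a b (\<lambda>t. complex_of_real B * g t)" by (rule L2_scale[OF g])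
  have "continuous_on {a..b} c" using c continuous_on_subset by blast
  note [measurable] = L2_measurable[OF g] L2_measurable[OF L2_continuous[OF this]]
  show L: "L2 a b (\<lambda>t. c t * g t)"
  proof (rule L2_I)
    show "integrable (restrict_space lborel {a..b}) (\<lambda>t. (cmod (c t * g t))^2)"
    proof (rule Bochner_Integration.integrable_bound[OF L2_integrable_square[OF Bg]])
      show "AE t in restrict_space lborel {a..b}.
          norm ((cmod (c t * g t))^2) \<le> norm ((cmod (complex_of_real B * g t))^2)"
        using le' by (intro AE_I2) (simp add: power_mono)
    qed measurable
  qed measurable
  have "L2_norm a b (\<lambda>t. c t * g t) \<le> L2_norm a b (\<lambda>t. complex_of_real B * g t)"
    by (intro L2_norm_mono Bg le')
  then show "L2_norm a b (\<lambda>t. c t * g t) \<le> B * L2_norm a b g" using B by (simp add: L2_norm_scale)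
qed

lemma reflection_operator:
  assumes c: "continuous_on UNIV c" "\<And>t. cmod (c t) \<le> B"
    and d: "continuous_on UNIV d" "\<And>t. cmod (d t) \<le> B"
  shows "L2_linear 0 b (\<lambda>g t. c t * g t + d t * g (b - t))"
    and "L2 0 b g \<Longrightarrow> L2_norm 0 b (\<lambda>t. c t * g t + d t * g (b - t)) \<le> 2 * B * L2_norm 0 b g"
proof -
  show "L2_linear 0 b (\<lambda>g t. c t * g t + d t * g (b - t))"
    unfolding L2_linear_def
  proof (intro conjI allI impI)
    show "L2 0 b (\<lambda>t. c t * g t + d t * g (b - t))" if "L2 0 b g" for g
      by (intro L2_add L2_mult_bounded(1)[OF _ c] L2_mult_bounded(1)[OF _ d] L2_reflect that)
  qed (simp add: algebra_simps)
  assume g: "L2 0 b g"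
  have "L2_norm 0 b (\<lambda>t. c t * g t + d t * g (b - t)) \<le>
      L2_norm 0 b (\<lambda>t. c t * g t) + L2_norm 0 b (\<lambda>t. d t * g (b - t))"
    by (intro L2_norm_triangle L2_mult_bounded(1)[OF _ c] L2_mult_bounded(1)[OF _ d] L2_reflect g)
  also have "\<dots> \<le> B * L2_norm 0 b g + B * L2_norm 0 b g"
    using L2_mult_bounded(2)[OF g c] L2_mult_bounded(2)[OF L2_reflect(1)[OF g] d]
    by (intro add_mono) (simp_all add: L2_reflect(2)[OF g])
  finally show "L2_norm 0 b (\<lambda>t. c t * g t + d t * g (b - t)) \<le> 2 * B * L2_norm 0 b g" by simp
qed

lemma abs_sin_diff_le: "\<bar>sin x - sin y\<bar> \<le> \<bar>x - y\<bar>" for x y :: real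
proof -
  have "\<bar>sin x - sin y\<bar> = 2 * (\<bar>sin ((x - y) / 2)\<bar> * \<bar>cos ((x + y) / 2)\<bar>)"
    by (simp add: sin_diff_sin abs_mult)
  also have "\<dots> \<le> 2 * (\<bar>(x - y) / 2\<bar> * 1)"
    by (intro mult_left_mono mult_mono abs_sin_x_le_abs_x abs_cos_le_one) auto
  finally show ?thesis by simp
qed

text \<open>The unperturbed frequencies enumerate \<open>\<bar>k + \<alpha>\<bar>\<close> for integers \<open>k\<close>.\<close>

definition base_freq :: "real \<Rightarrow> nat \<Rightarrow> real" where
  "base_freq \<alpha> n = (-1)^n * (of_int (int_decode n) + \<alpha>)"

lemma base_freq_even: "base_freq \<alpha> (2 * q) = real q + \<alpha>"
  by (simp add: base_freq_def int_decode_def sum_decode_def)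

lemma base_freq_odd: "base_freq \<alpha> (2 * q + 1) = real (Suc q) - \<alpha>"
  by (simp add: base_freq_def int_decode_def sum_decode_def)

lemma base_freq_pos: "0 < \<alpha> \<Longrightarrow> \<alpha> < 1 \<Longrightarrow> 0 < base_freq \<alpha> n"
  by (cases "even n") (auto elim!: evenE oddE simp: base_freq_even base_freq_odd simp del: One_nat_def)

text \<open>The map of the overview; the factor sqrt(2\<pi>) undoes the normalisation of
  \<open>fourier\<close>.\<close>

definition sin_op :: "real \<Rightarrow> (real \<Rightarrow> complex) \<Rightarrow> real \<Rightarrow> complex" where
  "sin_op \<alpha> g t = (sqrt (2 * pi) / (2 * \<i>) * cis (\<alpha> * t)) * g t
     + (- (sqrt (2 * pi) / (2 * \<i>) * cis (- (\<alpha> * t)))) * g (2 * pi - t)"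

text \<open>Cramer's rule for the system formed by the equation at t and the one at 2\<pi> -
  t.\<close>

definition sin_op_inv :: "real \<Rightarrow> (real \<Rightarrow> complex) \<Rightarrow> real \<Rightarrow> complex" where
  "sin_op_inv \<alpha> h t = (cis (\<alpha> * (2 * pi - t)) / (sqrt (2 * pi) * sin (2 * pi * \<alpha>))) * h t
     + (cis (- (\<alpha> * t)) / (sqrt (2 * pi) * sin (2 * pi * \<alpha>))) * h (2 * pi - t)"

lemma sin_op_fourier: "sin_op \<alpha> (fourier n) t = complex_of_real (sin (base_freq \<alpha> n * t))"
proof -
  define k where "k = int_decode n"
  \<comment> \<open>Since k is an integer, reflecting the interval amounts to conjugating the
    exponential.\<close>
  have 1: "cis (of_int k * (2 * pi - t)) = cis (- (of_int k * t))"
  proof -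
    have "cis (of_int k * (2 * pi - t)) = cis (2 * pi * of_int k) * cis (- (of_int k * t))"
      by (simp add: cis_mult algebra_simps)
    also have "cis (2 * pi * of_int k) = 1" by (rule cis_multiple_2pi) simp
    finally show ?thesis by simp
  qed
  have "sin_op \<alpha> (fourier n) t = (-1)^n / (2 * \<i>) *
      (cis (\<alpha> * t) * cis (of_int k * t) - cis (- (\<alpha> * t)) * cis (- (of_int k * t)))"
    unfolding sin_op_def fourier_def k_def[symmetric] 1 by (simp add: field_simps)
  also have "\<dots> = (-1)^n / (2 * \<i>) * (cis ((of_int k + \<alpha>) * t) - cis (- ((of_int k + \<alpha>) * t)))"
    by (simp add: cis_mult algebra_simps)
  also have "\<dots> = complex_of_real ((-1)^n * sin ((of_int k + \<alpha>) * t))"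
    by (simp add: complex_eq_iff cis.ctr)
  also have "(-1)^n * sin ((of_int k + \<alpha>) * t) = sin (base_freq \<alpha> n * t)"
    by (cases "even n") (simp_all add: base_freq_def k_def algebra_simps flip: sin_minus)
  finally show ?thesis .
qed

lemma sin_op_inverse:
  assumes "sin (2 * pi * \<alpha>) \<noteq> 0"
  shows "sin_op \<alpha> (sin_op_inv \<alpha> h) t = h t" and "sin_op_inv \<alpha> (sin_op \<alpha> h) t = h t"
proof -
  define w where "w = complex_of_real (sqrt (2 * pi))"
  define \<delta> where "\<delta> = complex_of_real (sin (2 * pi * \<alpha>))"
  define P where "P = cis (\<alpha> * t)"
  define Q where "Q = cis (\<alpha> * (2 * pi - t))"
  have nz: "w \<noteq> 0" "\<delta> \<noteq> 0" "P \<noteq> 0" "Q \<noteq> 0" using assms by (simp_all add: w_def \<delta>_def P_def Q_def)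
  have P': "cis (- (\<alpha> * t)) = inverse P" and Q': "cis (- (\<alpha> * (2 * pi - t))) = inverse Q"
    by (simp_all add: P_def Q_def cis_inverse)
  \<comment> \<open>The product does not depend on t, so one nonvanishing sine makes the 2 by 2
    systems invertible uniformly in t.\<close>
  have "P * Q = cis (2 * pi * \<alpha>)" by (simp add: P_def Q_def cis_mult algebra_simps)
  moreover have "inverse (P * Q) = cis (- (2 * pi * \<alpha>))" unfolding calculation by (simp add: cis_inverse)
  ultimately have PQ: "P * Q - inverse (P * Q) = 2 * \<i> * \<delta>"
    by (simp add: \<delta>_def complex_eq_iff)
  have "sin_op \<alpha> (sin_op_inv \<alpha> h) t = (P * Q - inverse (P * Q)) / (2 * \<i> * \<delta>) * h t"
    unfolding sin_op_def sin_op_inv_def of_real_mult w_def[symmetric] \<delta>_def[symmetric] P_def[symmetric] P'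
      Q_def[symmetric] Q' using nz
    by (simp add: field_simps P_def[symmetric] Q')
  then show "sin_op \<alpha> (sin_op_inv \<alpha> h) t = h t" unfolding PQ using nz by simp
  have "sin_op_inv \<alpha> (sin_op \<alpha> h) t = (P * Q - inverse (P * Q)) / (2 * \<i> * \<delta>) * h t"
    unfolding sin_op_def sin_op_inv_def of_real_mult w_def[symmetric] \<delta>_def[symmetric] P_def[symmetric] P'
      Q_def[symmetric] Q' using nz
    by (simp add: field_simps P_def[symmetric] Q')
  then show "sin_op_inv \<alpha> (sin_op \<alpha> h) t = h t" unfolding PQ using nz by simp
qed

section \<open>The Riesz basis of sines\<close>

lemma riesz_seq_sin:
  assumes \<alpha>: "0 < \<alpha>" "\<alpha> < 1" "sin (2 * pi * \<alpha>) \<noteq> 0"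
    and \<rho>: "\<And>n. 0 < \<rho> n" "inj \<rho>"
    and summ: "summable (\<lambda>n. (\<rho> n - base_freq \<alpha> n)^2)"
  shows "fourier.riesz_seq (\<lambda>n t. complex_of_real (sin (\<rho> n * t)))"
proof -
  define \<kappa> where "\<kappa> = (\<lambda>n. (\<rho> n - base_freq \<alpha> n)^2)"
  have \<kappa>: "summable \<kappa>" "\<And>n. 0 \<le> \<kappa> n" using summ by (auto simp: \<kappa>_def)
  \<comment> \<open>\<open>s\<close> bounds the norm of \<open>sin_op_inv\<close>, being twice the
    modulus of either coefficient; \<eta> is then chosen so that \<eta> * s * sqrt(2\<pi>) is
    exactly the 1/2 allowed by \<open>L2_iso_perturb\<close>.\<close>
  define s where "s = 2 / (sqrt (2 * pi) * \<bar>sin (2 * pi * \<alpha>)\<bar>)"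
  have s: "0 < s" using \<alpha>(3) by (simp add: s_def)
  define \<eta> where "\<eta> = 1 / (2 * s * sqrt (2 * pi))"
  have \<eta>: "0 < \<eta>" using s by (simp add: \<eta>_def)
  \<comment> \<open>The factor (2\<pi>)^2 is the maximum of t^2 on the interval, as two sines differ
    by at most t times the difference of their frequencies.\<close>
  have "(\<lambda>N. (2 * pi)^2 * (\<Sum>n. \<kappa> (n + N))) \<longlonglongrightarrow> (2 * pi)^2 * 0"
    by (intro tendsto_intros suminf_exist_split2 \<kappa>)
  then have "\<forall>\<^sub>F N in sequentially. (2 * pi)^2 * (\<Sum>n. \<kappa> (n + N)) < \<eta>^2"
    by (rule order_tendstoD) (use \<eta> in simp)
  then obtain N where N: "(2 * pi)^2 * (\<Sum>n. \<kappa> (n + N)) < \<eta>^2" by (auto simp: eventually_sequentially)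
  define \<omega> where "\<omega> = (\<lambda>n. if n < N then base_freq \<alpha> n else \<rho> n)"
  define \<kappa>' where "\<kappa>' = (\<lambda>n. if n < N then 0 else \<kappa> n)"
  have "(\<lambda>n. \<kappa>' (n + N)) sums (\<Sum>n. \<kappa> (n + N))"
    unfolding \<kappa>'_def using summable_ignore_initial_segment[OF \<kappa>(1), of N] by (simp add: summable_sums)
  then have "\<kappa>' sums ((\<Sum>n. \<kappa> (n + N)) + (\<Sum>n<N. \<kappa>' n))" by (simp only: sums_iff_shift)
  then have \<kappa>'_sums: "\<kappa>' sums (\<Sum>n. \<kappa> (n + N))" by (simp add: \<kappa>'_def)
  define d where "d = (\<lambda>n t. complex_of_real (sin (\<omega> n * t) - sin (base_freq \<alpha> n * t)))"
  have d_le: "(cmod (d n t))^2 \<le> t^2 * \<kappa>' n" for n t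
  proof -
    have "cmod (d n t) \<le> \<bar>\<omega> n * t - base_freq \<alpha> n * t\<bar>"
      unfolding d_def norm_of_real by (rule abs_sin_diff_le)
    also have "\<dots> = \<bar>t * (\<omega> n - base_freq \<alpha> n)\<bar>" by (simp add: algebra_simps)
    finally have "(cmod (d n t))^2 \<le> (t * (\<omega> n - base_freq \<alpha> n))^2"
      using power_mono[of "cmod (d n t)" _ 2] by fastforce
    then show ?thesis by (simp add: power_mult_distrib \<omega>_def \<kappa>'_def \<kappa>_def split: if_splits)
  qed
  have d_summ: "summable (\<lambda>n. (cmod (d n t))^2)" for t
    by (rule summable_comparison_test'[OF summable_mult[OF sums_summable[OF \<kappa>'_sums]]]) (use d_le in simp)
  have d_sum: "(\<Sum>n. (cmod (d n t))^2) \<le> \<eta>^2" if t: "t \<in> {0..2 * pi}" for t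
  proof -
    have "(\<Sum>n. (cmod (d n t))^2) \<le> (\<Sum>n. t^2 * \<kappa>' n)"
      by (intro suminf_le d_le d_summ summable_mult sums_summable[OF \<kappa>'_sums])
    also have "\<dots> = t^2 * (\<Sum>n. \<kappa> (n + N))"
      using \<kappa>'_sums by (simp add: suminf_mult sums_iff)
    also have "\<dots> \<le> (2 * pi)^2 * (\<Sum>n. \<kappa> (n + N))"
      using t \<kappa> by (intro mult_right_mono power_mono suminf_nonneg summable_ignore_initial_segment) auto
    finally show ?thesis using N by simp
  qed
  have L2d: "L2 0 (2 * pi) (d n)" for n
    unfolding d_def by (intro L2_continuous continuous_intros)
  define D where "D = (\<lambda>g t. \<Sum>n. fourier.coef g n * d n t)"
  have D: "L2_linear 0 (2 * pi) D"
    "\<And>g t. L2 0 (2 * pi) g \<Longrightarrow> t \<in> {0..2 * pi} \<Longrightarrow> cmod (D g t) \<le> \<eta> * L2_norm 0 (2 * pi) g"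
    "\<And>n. D (fourier n) = d n"
    unfolding D_def using fourier.coef_series_operator[of d \<eta>] L2d d_summ d_sum \<eta> by simp_all
  let ?B = "sqrt (2 * pi) / 2"
  let ?c = "\<lambda>t. sqrt (2 * pi) / (2 * \<i>) * cis (\<alpha> * t)"
  let ?d = "\<lambda>t. - (sqrt (2 * pi) / (2 * \<i>) * cis (- (\<alpha> * t)))"
  have "continuous_on UNIV ?c" "continuous_on UNIV ?d"
    unfolding cis_conv_exp by (intro continuous_intros; simp)+
  moreover have "cmod (?c t) \<le> ?B" "cmod (?d t) \<le> ?B" for t
    by (simp_all add: norm_mult norm_divide)
  ultimately have T0: "L2_linear 0 (2 * pi) (sin_op \<alpha>)"
    "\<And>g. L2 0 (2 * pi) g \<Longrightarrow> L2_norm 0 (2 * pi) (sin_op \<alpha> g) \<le> 2 * ?B * L2_norm 0 (2 * pi) g"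
    using reflection_operator[of ?c ?B ?d "2 * pi"] unfolding sin_op_def by blast+
  let ?C = "1 / (sqrt (2 * pi) * \<bar>sin (2 * pi * \<alpha>)\<bar>)"
  let ?c = "\<lambda>t. cis (\<alpha> * (2 * pi - t)) / (sqrt (2 * pi) * sin (2 * pi * \<alpha>))"
  let ?d = "\<lambda>t. cis (- (\<alpha> * t)) / (sqrt (2 * pi) * sin (2 * pi * \<alpha>))"
  have "continuous_on UNIV ?c" "continuous_on UNIV ?d"
    unfolding cis_conv_exp by (intro continuous_intros; use \<alpha>(3) in simp)+
  moreover have "cmod (?c t) \<le> ?C" "cmod (?d t) \<le> ?C" for t
    by (simp_all add: norm_mult norm_divide)
  ultimately have S0: "L2_linear 0 (2 * pi) (sin_op_inv \<alpha>)"
    "\<And>g. L2 0 (2 * pi) g \<Longrightarrow> L2_norm 0 (2 * pi) (sin_op_inv \<alpha> g) \<le> 2 * ?C * L2_norm 0 (2 * pi) g"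
    using reflection_operator[of ?c ?C ?d "2 * pi"] unfolding sin_op_inv_def by blast+
  have small: "\<eta> * s * sqrt (2 * pi - 0) \<le> 1 / 2" using s by (simp add: \<eta>_def)
  have "L2_iso 0 (2 * pi) (\<lambda>g t. sin_op \<alpha> g t + D g t)"
  proof (rule L2_iso_perturb[OF _ T0(1) S0(1) D(1) T0(2) _ _ _ _ D(2) _ small])
    show "L2_norm 0 (2 * pi) (sin_op_inv \<alpha> g) \<le> s * L2_norm 0 (2 * pi) g" if "L2 0 (2 * pi) g" for g
      using S0(2)[OF that] by (simp add: s_def)
  qed (use s \<eta> in \<open>auto simp: sin_op_inverse[OF \<alpha>(3)]\<close>)
  moreover have "sin_op \<alpha> (fourier n) t + D (fourier n) t = complex_of_real (sin (\<omega> n * t))" for n t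
    unfolding D(3) sin_op_fourier d_def by simp
  ultimately have "fourier.riesz_seq (\<lambda>n t. complex_of_real (sin (\<omega> n * t)))"
    unfolding fourier.riesz_seq_def by blast
  \<comment> \<open>So far the first N frequencies are still the unperturbed ones; they are now
    exchanged for the true ones.\<close>
  from fourier.riesz_seq_sin_finite_change[where N=N, OF refl _ this] show ?thesis
    using \<rho> base_freq_pos[OF \<alpha>(1,2)] by (simp add: \<omega>_def)
qed

text \<open>In the vector space of all functions, the subspace of square integrable ones has an
  algebraic complement by basis extension; \<open>P\<close> is a left inverse of the inclusion.
  Composing with it turns an \<open>L2_linear\<close> operator into one that is linear on all
  functions.\<close>

lemma L2_linear_projection:
  obtains P :: "(real \<Rightarrow> complex) \<Rightarrow> real \<Rightarrow> complex" where
    "\<And>g. L2 a b (P g)" "\<And>g. L2 a b g \<Longrightarrow> P g = g"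
    "\<And>g h \<alpha> \<beta>. P (\<lambda>t. \<alpha> * g t + \<beta> * h t) = (\<lambda>t. \<alpha> * P g t + \<beta> * P h t)"
proof -
  define sc where "sc = (\<lambda>(c :: complex) (f :: real \<Rightarrow> complex) t. c * f t)"
  interpret vs: vector_space sc
    by unfold_locales (auto simp: sc_def fun_eq_iff algebra_simps)
  interpret vp: vector_space_pair sc sc ..
  have sub: "vs.subspace {g. L2 a b g}"
    unfolding vs.subspace_def by (auto simp: sc_def zero_fun_def plus_fun_def intro: L2_add L2_scale)
  have "Vector_Spaces.linear sc sc id" by (rule vs.linear_id)
  from vp.linear_exists_left_inverse_on[OF this sub]
  obtain P where P: "range P \<subseteq> {g. L2 a b g}" "Vector_Spaces.linear sc sc P" "\<And>g. L2 a b g \<Longrightarrow> P (id g) = g"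
    by auto
  show ?thesis
  proof (rule that)
    show "P (\<lambda>t. \<alpha> * g t + \<beta> * h t) = (\<lambda>t. \<alpha> * P g t + \<beta> * P h t)" for g h \<alpha> \<beta>
    proof -
      interpret l: Vector_Spaces.linear sc sc P by (rule P(2))
      have "P (sc \<alpha> g + sc \<beta> h) = sc \<alpha> (P g) + sc \<beta> (P h)" by (simp add: l.add l.scale)
      then show ?thesis by (simp add: sc_def plus_fun_def)
    qed
    show "L2 a b (P g)" for g using P(1) by blast
    show "P g = g" if "L2 a b g" for g using P(3)[OF that] by simp
  qed
qed

lemma (in L2_onb) riesz_seq_imp_L2_riesz_basis:
  assumes "riesz_seq f" and idx: "bij_betw idx I UNIV" and F: "\<And>i. i \<in> I \<Longrightarrow> F i = f (idx i)"
  shows "L2_riesz_basis a b F I"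
proof -
  obtain T where T: "L2_iso a b T" and Te: "\<And>n t. t \<in> {a..b} \<Longrightarrow> T (e n) t = f n t"
    using assms(1) unfolding riesz_seq_def by blast
  have lin: "L2_linear a b T" using T unfolding L2_iso_def by blast
  obtain C where C: "\<And>g. L2 a b g \<Longrightarrow> L2_norm a b (T g) \<le> C * L2_norm a b g"
    using T unfolding L2_iso_def by blast
  obtain D where D: "\<And>g. L2 a b g \<Longrightarrow> L2_norm a b g \<le> D * L2_norm a b (T g)"
    using T unfolding L2_iso_def by blast
  have surj: "\<And>h. L2 a b h \<Longrightarrow> \<exists>g. L2 a b g \<and> L2_norm a b (\<lambda>t. T g t - h t) = 0"
    using T unfolding L2_iso_def by blast
  \<comment> \<open>\<open>L2_riesz_basis\<close> asks for linearity on all functions, not only on square integrable ones\<close>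
  obtain P where P: "\<And>g. L2 a b (P g)" "\<And>g. L2 a b g \<Longrightarrow> P g = g"
    "\<And>g h \<alpha> \<beta>. P (\<lambda>t. \<alpha> * g t + \<beta> * h t) = (\<lambda>t. \<alpha> * P g t + \<beta> * P h t)"
    by (rule L2_linear_projection[of a b]) blast
  have onb: "L2_orthonormal_basis a b (\<lambda>i. e (idx i)) I"
    unfolding L2_orthonormal_basis_def
  proof (intro conjI ballI allI impI)
    show "L2 a b (e (idx i))" for i by (rule L2_e)
    show "L2_inner a b (e (idx i)) (e (idx j)) = (if i = j then 1 else 0)" if "i \<in> I" "j \<in> I" for i j
      using that inj_on_eq_iff[OF bij_betw_imp_inj_on[OF idx]] by (simp add: orthonormal)
    show "L2_norm a b g = 0" if g: "L2 a b g" "\<forall>i\<in>I. L2_inner a b g (e (idx i)) = 0" for g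
    proof -
      have "coef g n = 0" for n
        using g(2) bij_betw_imp_surj_on[OF idx] by (metis UNIV_I imageE)
      then show ?thesis by (rule coef_zero_imp_norm_zero[OF g(1)])
    qed
  qed
  show ?thesis
    unfolding L2_riesz_basis_def
  proof (rule exI[of _ "\<lambda>i. e (idx i)"], rule exI[of _ "\<lambda>g. T (P g)"], rule exI[of _ C],
      rule exI[of _ D], intro conjI ballI allI impI)
    show "L2_orthonormal_basis a b (\<lambda>i. e (idx i)) I" by (rule onb)
    show "L2 a b (T (P g))" for g by (rule L2_linear_L2[OF lin P(1)])
    show "T (P (\<lambda>t. \<alpha> * g t + \<beta> * h t)) = (\<lambda>t. \<alpha> * T (P g) t + \<beta> * T (P h) t)" for g h \<alpha> \<beta>
      unfolding P(3) by (rule L2_linear_comb[OF lin P(1) P(1)])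
    show "L2_norm a b (T (P g)) \<le> C * L2_norm a b g" if "L2 a b g" for g
      using C[OF that] P(2)[OF that] by simp
    show "L2_norm a b g \<le> D * L2_norm a b (T (P g))" if "L2 a b g" for g
      using D[OF that] P(2)[OF that] by simp
    show "\<exists>g. L2 a b g \<and> L2_norm a b (\<lambda>t. T (P g) t - h t) = 0" if h: "L2 a b h" for h
    proof -
      obtain g where "L2 a b g" "L2_norm a b (\<lambda>t. T g t - h t) = 0" using surj[OF h] by blast
      then show ?thesis by (intro exI[of _ g]) (simp add: P(2))
    qed
    show "L2_norm a b (\<lambda>t. T (P (e (idx i))) t - F i t) = 0" if "i \<in> I" for i
    proof -
      have "L2_norm a b (\<lambda>t. T (P (e (idx i))) t - F i t) = L2_norm a b (\<lambda>t. 0)"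
        by (intro L2_norm_cong) (simp add: P(2) L2_e Te F that)
      then show ?thesis by simp
    qed
  qed
qed

text \<open>The remainders are indexed from 1, hence the \<open>Suc\<close>, which drops the term at
  0.\<close>

lemma summable_interleave:
  fixes x y :: "nat \<Rightarrow> real"
  assumes x: "summable x" "\<And>n. 0 \<le> x n" and y: "summable y" "\<And>n. 0 \<le> y n"
  shows "summable (\<lambda>n. if even n then x (Suc (n div 2)) else y (Suc (n div 2)))" (is "summable ?z")
proof (rule summableI_nonneg_bounded)
  have x': "summable (\<lambda>n. x (Suc n))" and y': "summable (\<lambda>n. y (Suc n))"
    using x(1) y(1) by (simp_all add: summable_Suc_iff)
  show "0 \<le> ?z n" for n using x y by simp
  fix n
  have double: "(\<Sum>i<2 * m. ?z i) = (\<Sum>i<m. x (Suc i)) + (\<Sum>i<m. y (Suc i))" for m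
    by (induction m) (simp_all add: algebra_simps)
  \<comment> \<open>Doubling the length completes all pairs, so that the sum splits into the two
    series.\<close>
  have "sum ?z {..<n} \<le> sum ?z {..<2 * n}" using x y by (intro sum_mono2) auto
  also have "\<dots> \<le> (\<Sum>i. x (Suc i)) + (\<Sum>i. y (Suc i))"
    unfolding double using x y by (intro add_mono sum_le_suminf x' y') auto
  finally show "sum ?z {..<n} \<le> (\<Sum>i. x (Suc i)) + (\<Sum>i. y (Suc i))" .
qed

theorem theorem4:
  fixes m p :: nat
    and sig :: "nat \<Rightarrow> real \<Rightarrow> real"
    and mu :: "nat \<Rightarrow> nat \<Rightarrow> real"
  assumes hm: "m \<ge> 4"
    and hp: "2 \<le> p" "p \<le> m - 2"
    and hsig: "\<forall>j\<in>{1..m}. real_L2_on {0..pi} (sig j)"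
    and heig: "\<forall>n\<ge>1. \<forall>k\<in>{1,2}. L0_eigenvalue m p sig (complex_of_real (mu n k))"
    and hasym: "\<exists>\<kappa>1 \<kappa>2 :: nat \<Rightarrow> real.
        summable (\<lambda>n. (\<kappa>1 n)^2) \<and> summable (\<lambda>n. (\<kappa>2 n)^2) \<and>
        (\<forall>n\<ge>1. sqrt (mu n 1) = real n - 1 + arccos (sqrt (real (p+1) / real m)) / pi + \<kappa>1 n \<and>
                sqrt (mu n 2) = real n - arccos (sqrt (real (p+1) / real m)) / pi + \<kappa>2 n)"
    and A2: "\<forall>n\<ge>1. \<forall>k\<in>{1,2}.
        (\<forall>j\<in>{1..p+1}. C_pi (sig j) (complex_of_real (mu n k)) \<noteq> 0) \<and>
        (\<forall>j\<in>{p+1..m}. S_pi (sig j) (complex_of_real (mu n k)) \<noteq> 0)"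
    and A5: "\<forall>n\<ge>1. \<forall>k\<in>{1,2}. \<forall>n'\<ge>1. \<forall>k'\<in>{1,2}.
                (n, k) \<noteq> (n', k') \<longrightarrow> mu n k \<noteq> mu n' k'"
        "\<forall>n\<ge>1. \<forall>k\<in>{1,2}. mu n k > 0"
  shows "L2_riesz_basis 0 (2 * pi)
           (\<lambda>(n, k) t. complex_of_real (sin (sqrt (mu n k) * t)))
           {(n, k). n \<ge> 1 \<and> k \<in> {1, 2}}"
proof -
  define \<alpha> where "\<alpha> = arccos (sqrt (real (p+1) / real m)) / pi"
  define c where "c = sqrt (real (p+1) / real m)"
  \<comment> \<open>p + 1 < m gives \<alpha> > 0, and p + 1 > 0 gives \<alpha> < 1/2; thus
    2\<pi>\<alpha> lies strictly between 0 and \<pi>, where the sine does not vanish.\<close>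
  have "real (p+1) / real m < 1" using hm hp by simp
  then have c: "0 < c" "c < 1" using hm hp by (simp_all add: c_def)
  have "0 < arccos c" "arccos c < pi / 2"
    using arccos_less_arccos[of c 1] arccos_less_arccos[of 0 c] c by simp_all
  then have \<alpha>: "0 < \<alpha>" "\<alpha> < 1 / 2" unfolding \<alpha>_def c_def[symmetric] by (simp_all add: field_simps)
  have "0 < sin (2 * pi * \<alpha>)" using \<alpha> by (intro sin_gt_zero) auto
  obtain \<kappa>1 \<kappa>2 where \<kappa>: "summable (\<lambda>n. (\<kappa>1 n)^2)" "summable (\<lambda>n. (\<kappa>2 n)^2)"
    and \<mu>: "\<And>n. n \<ge> 1 \<Longrightarrow> sqrt (mu n 1) = real n - 1 + \<alpha> + \<kappa>1 n"
      "\<And>n. n \<ge> 1 \<Longrightarrow> sqrt (mu n 2) = real n - \<alpha> + \<kappa>2 n"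
    using hasym unfolding \<alpha>_def by blast
  define I where "I = {(n :: nat, k :: nat). n \<ge> 1 \<and> k \<in> {1, 2}}"
  \<comment> \<open>The two families are interleaved: (n, 1) goes to 2(n - 1) and (n, 2) to 2(n - 1)
    + 1, matching the values n - 1 + \<alpha> and n - \<alpha> of \<open>base_freq\<close> at even
    and odd indices. On \<open>I\<close> the natural number subtractions are not truncated.\<close>
  define idx where "idx = (\<lambda>(n :: nat, k :: nat). 2 * (n - 1) + (k - 1))"
  define idx' where "idx' = (\<lambda>i :: nat. (Suc (i div 2), Suc (i mod 2)))"
  define \<rho> where "\<rho> = (\<lambda>i. case idx' i of (n, k) \<Rightarrow> sqrt (mu n k))"
  have idx': "idx' i \<in> I" "idx (idx' i) = i" for i
    by (auto simp: I_def idx'_def idx_def)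
  have idx: "idx' (idx i) = i" if "i \<in> I" for i
    using that by (auto simp: I_def idx'_def idx_def)
  have "bij_betw idx I UNIV"
    by (rule bij_betw_byWitness[where f'=idx']) (use idx idx' in auto)
  moreover have "fourier.riesz_seq (\<lambda>i t. complex_of_real (sin (\<rho> i * t)))"
  proof (rule riesz_seq_sin[of \<alpha>])
    show "0 < \<rho> i" for i
      using A5(2) idx'(1)[of i] by (auto simp: \<rho>_def I_def)
    show "inj \<rho>"
    proof (rule injI)
      fix i j assume eq: "\<rho> i = \<rho> j"
      obtain n k n' k' where nk: "idx' i = (n, k)" "idx' j = (n', k')" by force
      then have "mu n k = mu n' k'" using eq by (simp add: \<rho>_def)
      moreover have "(n, k) \<in> I" "(n', k') \<in> I" using idx'(1) nk by metis+
      ultimately have "(n, k) = (n', k')" using A5(1) unfolding I_def by blast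
      then show "i = j" using idx'(2) nk by metis
    qed
    have "\<rho> i - base_freq \<alpha> i = (if even i then \<kappa>1 (Suc (i div 2)) else \<kappa>2 (Suc (i div 2)))" for i
    proof (cases "even i")
      case True
      then obtain q where "i = 2 * q" by (elim evenE)
      then show ?thesis using \<mu>(1)[of "Suc q"] by (simp add: \<rho>_def idx'_def base_freq_even)
    next
      case False
      then obtain q where q: "i = 2 * q + 1" by (elim oddE)
      have "idx' i = (Suc q, 2)" by (simp add: idx'_def q)
      then show ?thesis using \<mu>(2)[of "Suc q"] False unfolding q base_freq_odd by (simp add: \<rho>_def)
    qed
    then show "summable (\<lambda>i. (\<rho> i - base_freq \<alpha> i)^2)"
      using summable_interleave[OF \<kappa>(1) _ \<kappa>(2)] by (simp add: if_distrib[of "\<lambda>x. x^2"] cong: if_cong)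
  qed (use \<alpha> \<open>0 < sin (2 * pi * \<alpha>)\<close> in auto)
  moreover have "(case i of (n, k) \<Rightarrow> \<lambda>t. complex_of_real (sin (sqrt (mu n k) * t))) =
      (\<lambda>t. complex_of_real (sin (\<rho> (idx i) * t)))" if "i \<in> I" for i
    unfolding \<rho>_def idx[OF that] by (simp add: case_prod_beta)
  ultimately show ?thesis
    unfolding I_def[symmetric] by (intro fourier.riesz_seq_imp_L2_riesz_basis)
qed

end
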